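(* Let $B\subseteq\mathcal B(H)$ with $H$ a finite-dimensional Hilbert space, and let $\Phi:\mathcal B(L^2(B))\to B\otimes B^{\mathrm{op}}$ be either of the linear isomorphisms $\Psi_{0,1/2}:\theta_{\Lambda(a),\Lambda(b)}\mapsto a^*\otimes\sigma_{i/2}(b)$ or $\Psi'_{1/2,0}:\theta_{\Lambda(a),\Lambda(b)}\mapsto\sigma_{i/2}(b)\otimes a^*$. Then the assignments $A\mapsto e=\Phi(A)$, $e\mapsto V=\mathrm{Im}(e)\subseteq H\otimes\overline H$, and $V\mapsto S$ (the subspace of $\mathcal B(H)$ corresponding to $V$ under $\mathcal B(H)\cong H\otimes\overline H$) give bijections between: (1) self-adjoint $A\in\mathcal B(L^2(B))$ satisfying $m(A\otimes A)m^*=A$ and $(1\otimes\eta^*m)(1\otimes A\otimes1)(m^*\eta\otimes1)=A$ (or, equivalently, self-adjoint $A$ satisfying $m(A\otimes A)m^*=A$ and $(\eta^*m\otimes1)(1\otimes A\otimes1)(1\otimes m^*\eta)=A$); (2) orthogonal projections $e\in B\otimes B^{\mathrm{op}}$ with $e=\sigma(e)$ and such that $e=(\sigma_z\otimes\sigma_z)(e)$ for all $z\in\mathbb C$; (3) subspaces $V\subseteq H\otimes\overline H$ which are $B'\otimes(B')^{\mathrm{op}}$-invariant and satisfy $J_0(V)=V$ and $(Q\otimes(Q^{-1})^\top)(V)\subseteq V$ (equivalently, $(Q\otimes(Q^{-1})^\top)(V)=V$); (4) self-adjoint $B'$-bimodules $S\subseteq\mathcal B(H)$ with $QSQ^{-1}\subseteq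 S$ (equivalently, $QSQ^{-1}=S$).
   Context: Throughout, $B$ is a finite-dimensional $C^*$-algebra, $B\cong\bigoplus_k M_{n_k}(\mathbb C)$, $\mathrm{Tr}$ is the sum of the non-normalised matrix traces, $\psi$ is a faithful state on $B$, and $Q\in B$ is the unique positive invertible element with $\psi(a)=\mathrm{Tr}(Qa)$ for all $a\in B$. Inner products $(\cdot|\cdot)$ are linear in the right variable. $L^2(B)$ is the GNS space of $\psi$ with GNS map $\Lambda:B\to L^2(B)$ (a linear bijection), $(\Lambda(a)|\Lambda(b))=\psi(a^*b)$, and $B$ acts by $a\Lambda(b)=\Lambda(ab)$. $m:L^2(B)\otimes L^2(B)\to L^2(B)$ is $\Lambda(a)\otimes\Lambda(b)\mapsto\Lambda(ab)$, $m^*$ its Hilbert space adjoint; $\eta:\mathbb C\to L^2(B)$ is $\lambda\mapsto\lambda\Lambda(1)$, $\eta^*$ its adjoint. $\sigma_z(a)=Q^{iz}aQ^{-iz}$ for $z\in\mathbb C$, $a\in B$. For vectors $\xi,\eta$, $\theta_{\xi,\eta}(\zeta)=(\xi|\zeta)\eta$; the operators $\theta_{\Lambda(a),\Lambda(b)}$ span $\mathcal B(L^2(B))$, and $\Psi_{0,1/2},\Psi'_{1/2,0}$ are extended linearly. $B^{\mathrm{op}}$ is $B$ as a $*$-vector space with reversed product, and $\sigma_z$ acts on $B^{\mathrm{op}}$ as the same linear map. $\sigma:B\otimes B^{\mathrm{op}}\to B\otimes B^{\mathrm{op}}$ is the swap $a\otimes b\mapsto b\otimes a$. $B$ is a unital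 $*$-subalgebra of $\mathcal B(H)$ and $B'$ is its commutant. $\overline H$ is the conjugate Hilbert space, and for $x\in\mathcal B(H)$, $x^\top\in\mathcal B(\overline H)$ is $x^\top(\overline\xi)=\overline{x^*\xi}$. $B\otimes B^{\mathrm{op}}$ acts on $H\otimes\overline H$ by $a\otimes b\mapsto a\otimes b^\top$, and $B'\otimes(B')^{\mathrm{op}}$ acts by the same formula. $\mathcal B(H)$ is linearly identified with $H\otimes\overline H$ via $\theta_{\xi,\eta}\mapsto\eta\otimes\overline\xi$. $J_0$ is the antilinear map on $H\otimes\overline H$ with $J_0(\eta\otimes\overline\xi)=\xi\otimes\overline\eta$. A $B'$-bimodule in $\mathcal B(H)$ is a subspace $S$ with $xsy\in S$ for $x,y\in B'$, $s\in S$; it is self-adjoint if $S^*=S$. *)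

theory Defs
  imports "HOL-Analysis.Analysis"
begin

text \<open>
  A finite-dimensional Hilbert space is a coordinate space \<open>complex^'n\<close> with its standard
  inner product, operators between such spaces are matrices, and the Hilbert space tensor product
  of \<open>complex^'m\<close> and \<open>complex^'n\<close> is \<open>complex^('m \<times> 'n)\<close>.
\<close>

section \<open>Complex matrices\<close>

definition cinner :: "complex^'n \<Rightarrow> complex^'n \<Rightarrow> complex" where
  "cinner v w = (\<Sum>i\<in>UNIV. cnj (v$i) * w$i)"

definition cadj :: "complex^'m^'n \<Rightarrow> complex^'n^'m" where
  "cadj A = (\<chi> i j. cnj (A$j$i))"

definition cscale :: "complex \<Rightarrow> complex^'m^'n \<Rightarrow> complex^'m^'n" where
  "cscale c A = (\<chi> i j. c * A$i$j)"

interpretation cmat: vector_space "cscale :: complex \<Rightarrow> complex^'m^'n \<Rightarrow> complex^'m^'n"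
  by unfold_locales (simp_all add: cscale_def vec_eq_iff algebra_simps)

definition clinear_on ::
    "'a::ab_group_add set \<Rightarrow> (complex \<Rightarrow> 'a \<Rightarrow> 'a) \<Rightarrow> (complex \<Rightarrow> 'b \<Rightarrow> 'b) \<Rightarrow> ('a \<Rightarrow> 'b::ab_group_add) \<Rightarrow> bool"
  where "clinear_on X s1 s2 f \<longleftrightarrow>
    (\<forall>x\<in>X. \<forall>y\<in>X. f (x + y) = f x + f y) \<and> (\<forall>c. \<forall>x\<in>X. f (s1 c x) = s2 c (f x))"

definition positive_op :: "complex^'n^'n \<Rightarrow> bool" where
  "positive_op A \<longleftrightarrow> (\<forall>v. cinner v (A *v v) \<in> \<real>\<^sub>\<ge>\<^sub>0)"

definition theta :: "complex^'m \<Rightarrow> complex^'n \<Rightarrow> complex^'m^'n" where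
  "theta \<xi> \<eta> = (\<chi> i j. \<eta>$i * cnj (\<xi>$j))"

definition tensor_vec :: "complex^'m \<Rightarrow> complex^'n \<Rightarrow> complex^('m \<times> 'n)" where
  "tensor_vec v w = (\<chi> i. v $ fst i * w $ snd i)"

definition kron :: "complex^'m^'n \<Rightarrow> complex^'q^'p \<Rightarrow> complex^('m \<times> 'q)^('n \<times> 'p)" where
  "kron A B = (\<chi> i j. A $ fst i $ fst j * B $ snd i $ snd j)"

lemma cinner_cadj: "cinner (cadj A *v v) w = cinner v (A *v w)"
proof -
  have "cinner (cadj A *v v) w = (\<Sum>i\<in>UNIV. \<Sum>j\<in>UNIV. A$j$i * cnj (v$j) * w$i)"
    by (simp add: cinner_def cadj_def matrix_vector_mult_def sum_distrib_right)
  also have "\<dots> = (\<Sum>j\<in>UNIV. \<Sum>i\<in>UNIV. A$j$i * cnj (v$j) * w$i)"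
    by (rule sum.swap)
  also have "\<dots> = cinner v (A *v w)"
    by (simp add: cinner_def matrix_vector_mult_def sum_distrib_left mult_ac)
  finally show ?thesis .
qed

lemma theta_apply: "theta \<xi> \<eta> *v \<zeta> = cinner \<xi> \<zeta> *s \<eta>"
  by (simp add: theta_def cinner_def matrix_vector_mult_def vec_eq_iff sum_distrib_left mult_ac)

lemma kron_apply: "kron A B *v tensor_vec v w = tensor_vec (A *v v) (B *v w)"
  by (simp add: kron_def tensor_vec_def matrix_vector_mult_def vec_eq_iff sum_product
      sum.cartesian_product case_prod_unfold mult_ac)

lemma kron_mult: "kron A B ** kron C D = kron (A ** C) (B ** D)"
  by (simp add: kron_def matrix_matrix_mult_def vec_eq_iff sum_product
      sum.cartesian_product case_prod_unfold mult_ac)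

lemma cadj_kron: "cadj (kron A B) = kron (cadj A) (cadj B)"
  by (simp add: kron_def cadj_def vec_eq_iff)

text \<open>
  \<open>basis_map f\<close> sends the basis vector \<open>e\<^sub>j\<close> to \<open>e\<^bsub>f j\<^esub>\<close>.  It is used for the
  canonical identifications of iterated tensor products, the scalars being \<open>complex^1\<close>.
\<close>

definition basis_map :: "('m \<Rightarrow> 'n) \<Rightarrow> complex^'m^'n" where
  "basis_map f = (\<chi> i j. if f j = i then 1 else 0)"

text \<open>
  Complex powers of a diagonalisable matrix: the matrix acting as \<open>\<lambda> powr w\<close> on the eigenspace
  of \<open>\<lambda>\<close>.  It is unique because the eigenspaces span; \<open>\<lambda> > 0\<close> if \<open>Q\<close> is positive and
  invertible, so that \<open>\<lambda> powr w = exp (w * ln \<lambda>)\<close> with the real logarithm.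
\<close>

definition mat_cpow :: "complex^'n^'n \<Rightarrow> complex \<Rightarrow> complex^'n^'n" where
  "mat_cpow Q w = (THE P. \<forall>\<mu> v. Q *v v = \<mu> *s v \<longrightarrow> P *v v = (\<mu> powr w) *s v)"

lemma mat_cpow_diagonalisable:
  fixes Q U U' :: "complex^'n^'n"
  assumes U: "U ** U' = mat 1" "U' ** U = mat 1"
    and Q: "Q = U ** (\<chi> i j. if i = j then d i else 0) ** U'"
  shows "mat_cpow Q w = U ** (\<chi> i j. if i = j then d i powr w else 0) ** U'"
proof -
  define D where "D h = (\<chi> i j. if i = j then h i else (0::complex))" for h :: "'n \<Rightarrow> complex"
  have D: "(D h *v v) $ i = h i * v $ i" for h v i
    by (simp add: D_def matrix_vector_mult_def if_distrib[of "\<lambda>x. x * _"] cong: if_cong)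
  have QD: "Q = U ** D d ** U'"
    using Q by (simp add: D_def)
  show ?thesis
    unfolding mat_cpow_def D_def[symmetric]
  proof (rule the_equality, intro allI impI)
    fix \<mu> v assume eig: "Q *v v = \<mu> *s v"
    have "D d *v (U' *v v) = (U' ** U) *v (D d *v (U' *v v))"
      by (simp add: U)
    also have "\<dots> = U' *v (Q *v v)"
      by (simp add: QD matrix_vector_mul_assoc matrix_mul_assoc)
    also have "\<dots> = \<mu> *s (U' *v v)"
      by (simp add: eig vector_scalar_commute)
    finally have "d i * (U' *v v) $ i = \<mu> * (U' *v v) $ i" for i
      by (metis D vector_smult_component)
    then have "D (\<lambda>i. d i powr w) *v (U' *v v) = (\<mu> powr w) *s (U' *v v)"
      by (auto simp: vec_eq_iff D)
    then have "U *v (D (\<lambda>i. d i powr w) *v (U' *v v)) = (\<mu> powr w) *s ((U ** U') *v v)"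
      by (simp add: vector_scalar_commute matrix_vector_mul_assoc)
    then show "(U ** D (\<lambda>i. d i powr w) ** U') *v v = (\<mu> powr w) *s v"
      by (simp add: U matrix_vector_mul_assoc matrix_mul_assoc)
  next
    fix P assume P: "\<forall>\<mu> v. Q *v v = \<mu> *s v \<longrightarrow> P *v v = (\<mu> powr w) *s v"
    have axis_entry: "(A *v axis i 1) $ k = A $ k $ i" for A :: "complex^'n^'n" and i k
      by (simp add: matrix_vector_mult_def axis_def if_distrib[of "\<lambda>x. _ * x"] cong: if_cong)
    have ax: "D h *v axis i 1 = h i *s axis i 1" for h i
      by (simp add: vec_eq_iff D axis_def)
    have "(P ** U) *v axis i 1 = (U ** D (\<lambda>i. d i powr w)) *v axis i 1" for i
    proof -
      have "Q *v (U *v axis i 1) = U *v (D d *v ((U' ** U) *v axis i 1))"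
        by (simp add: QD matrix_vector_mul_assoc matrix_mul_assoc)
      also have "\<dots> = d i *s (U *v axis i 1)"
        by (simp add: U ax vector_scalar_commute)
      finally have "P *v (U *v axis i 1) = (d i powr w) *s (U *v axis i 1)"
        using P by blast
      also have "\<dots> = U *v (D (\<lambda>i. d i powr w) *v axis i 1)"
        by (simp add: ax vector_scalar_commute)
      finally show ?thesis
        by (simp add: matrix_vector_mul_assoc)
    qed
    then have "P ** U = U ** D (\<lambda>i. d i powr w)"
      by (simp add: vec_eq_iff axis_entry)
    then have "P ** (U ** U') = U ** D (\<lambda>i. d i powr w) ** U'"
      by (simp add: matrix_mul_assoc)
    then show "P = U ** D (\<lambda>i. d i powr w) ** U'"
      by (simp add: U)
  qed
qed

section \<open>Finite-dimensional C*-algebras, traces and states\<close>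

definition unital_star_subalgebra :: "(complex^'n^'n) set \<Rightarrow> bool" where
  "unital_star_subalgebra B \<longleftrightarrow> cmat.subspace B \<and> mat 1 \<in> B \<and>
     (\<forall>a\<in>B. \<forall>b\<in>B. a ** b \<in> B) \<and> (\<forall>a\<in>B. cadj a \<in> B)"

definition commutant :: "(complex^'n^'n) set \<Rightarrow> (complex^'n^'n) set" where
  "commutant B = {x. \<forall>b\<in>B. x ** b = b ** x}"

text \<open>
  The direct sum of the full matrix algebras over the fibres of \<open>blk\<close>, realised as the
  block-diagonal matrices.  The library's \<open>trace\<close> restricts on it to the sum of the
  non-normalised traces of the blocks.
\<close>

definition block_diagonal :: "('d \<Rightarrow> nat) \<Rightarrow> (complex^'d^'d) set" where
  "block_diagonal blk = {x. \<forall>i j. blk i \<noteq> blk j \<longrightarrow> x$i$j = 0}"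

definition star_isomorphism ::
    "(complex^'n^'n) set \<Rightarrow> (complex^'d^'d) set \<Rightarrow> (complex^'n^'n \<Rightarrow> complex^'d^'d) \<Rightarrow> bool"
  where "star_isomorphism B C \<phi> \<longleftrightarrow> clinear_on B cscale cscale \<phi> \<and> bij_betw \<phi> B C \<and>
     (\<forall>a\<in>B. \<forall>b\<in>B. \<phi> (a ** b) = \<phi> a ** \<phi> b) \<and> (\<forall>a\<in>B. \<phi> (cadj a) = cadj (\<phi> a))"

definition faithful_state :: "(complex^'n^'n) set \<Rightarrow> (complex^'n^'n \<Rightarrow> complex) \<Rightarrow> bool" where
  "faithful_state B \<psi> \<longleftrightarrow> clinear_on B cscale (*) \<psi> \<and> \<psi> (mat 1) = 1 \<and>
     (\<forall>a\<in>B. \<psi> (cadj a ** a) \<in> \<real>\<^sub>\<ge>\<^sub>0) \<and> (\<forall>a\<in>B. \<psi> (cadj a ** a) = 0 \<longrightarrow> a = 0)"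

definition modular :: "complex^'n^'n \<Rightarrow> complex \<Rightarrow> complex^'n^'n \<Rightarrow> complex^'n^'n" where
  "modular Q z a = mat_cpow Q (\<i> * z) ** a ** mat_cpow Q (- \<i> * z)"

section \<open>The GNS space\<close>

text \<open>\<open>complex^'l\<close> is \<open>L\<^sup>2(B)\<close>, and \<open>\<Lambda>\<close> (only relevant on \<open>B\<close>) is the GNS map.\<close>

definition gns_map ::
    "(complex^'n^'n) set \<Rightarrow> (complex^'n^'n \<Rightarrow> complex) \<Rightarrow> (complex^'n^'n \<Rightarrow> complex^'l) \<Rightarrow> bool"
  where "gns_map B \<psi> \<Lambda> \<longleftrightarrow> clinear_on B cscale (*s) \<Lambda> \<and> bij_betw \<Lambda> B UNIV \<and>
     (\<forall>a\<in>B. \<forall>b\<in>B. cinner (\<Lambda> a) (\<Lambda> b) = \<psi> (cadj a ** b))"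

abbreviation gns_inv ::
    "(complex^'n^'n) set \<Rightarrow> (complex^'n^'n \<Rightarrow> complex^'l) \<Rightarrow> complex^'l \<Rightarrow> complex^'n^'n"
  where "gns_inv B \<Lambda> \<equiv> inv_into B \<Lambda>"

definition gns_mult ::
    "(complex^'n^'n) set \<Rightarrow> (complex^'n^'n \<Rightarrow> complex^'l) \<Rightarrow> complex^('l \<times> 'l)^'l"
  where "gns_mult B \<Lambda> =
    (\<chi> r p. \<Lambda> (gns_inv B \<Lambda> (axis (fst p) 1) ** gns_inv B \<Lambda> (axis (snd p) 1)) $ r)"

definition gns_unit :: "(complex^'n^'n \<Rightarrow> complex^'l) \<Rightarrow> complex^1^'l" where
  "gns_unit \<Lambda> = (\<chi> r _. \<Lambda> (mat 1) $ r)"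

text \<open>
  The maps \<open>A \<mapsto> (1 \<otimes> \<eta>\<^sup>* m)(1 \<otimes> A \<otimes> 1)(m\<^sup>* \<eta> \<otimes> 1)\<close> and
  \<open>A \<mapsto> (\<eta>\<^sup>* m \<otimes> 1)(1 \<otimes> A \<otimes> 1)(1 \<otimes> m\<^sup>* \<eta>)\<close>.
\<close>

definition transpose_r ::
    "(complex^'n^'n) set \<Rightarrow> (complex^'n^'n \<Rightarrow> complex^'l) \<Rightarrow> complex^'l^'l \<Rightarrow> complex^'l^'l"
  where "transpose_r B \<Lambda> A =
    (basis_map fst :: complex^('l \<times> 1)^'l)
    ** kron (mat 1) (cadj (gns_unit \<Lambda>) ** gns_mult B \<Lambda>)
    ** kron (mat 1) (kron A (mat 1))
    ** (basis_map (\<lambda>((i, j), k). (i, (j, k))) :: complex^(('l \<times> 'l) \<times> 'l)^('l \<times> ('l \<times> 'l)))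
    ** kron (cadj (gns_mult B \<Lambda>) ** gns_unit \<Lambda>) (mat 1)
    ** (basis_map (Pair 1) :: complex^'l^(1 \<times> 'l))"

definition transpose_l ::
    "(complex^'n^'n) set \<Rightarrow> (complex^'n^'n \<Rightarrow> complex^'l) \<Rightarrow> complex^'l^'l \<Rightarrow> complex^'l^'l"
  where "transpose_l B \<Lambda> A =
    (basis_map snd :: complex^(1 \<times> 'l)^'l)
    ** kron (cadj (gns_unit \<Lambda>) ** gns_mult B \<Lambda>) (mat 1)
    ** kron (kron (mat 1) A) (mat 1)
    ** (basis_map (\<lambda>(i, (j, k)). ((i, j), k)) :: complex^('l \<times> ('l \<times> 'l))^(('l \<times> 'l) \<times> 'l))
    ** kron (mat 1) (cadj (gns_mult B \<Lambda>) ** gns_unit \<Lambda>)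
    ** (basis_map (\<lambda>i. (i, 1)) :: complex^'l^('l \<times> 1))"

text \<open>
  The linear extension of \<open>\<theta>\<^bsub>\<Lambda>(a),\<Lambda>(b)\<^esub> \<mapsto> f a b\<close>, for \<open>f\<close> antilinear in \<open>a\<close> and linear
  in \<open>b\<close>; see \<open>theta_extend_theta\<close> below.
\<close>

definition theta_extend ::
    "(complex^'n^'n) set \<Rightarrow> (complex^'n^'n \<Rightarrow> complex^'l) \<Rightarrow>
     (complex^'n^'n \<Rightarrow> complex^'n^'n \<Rightarrow> complex^'k^'k) \<Rightarrow> complex^'l^'l \<Rightarrow> complex^'k^'k"
  where "theta_extend B \<Lambda> f A =
    (\<Sum>p\<in>UNIV. \<Sum>q\<in>UNIV. cscale (A$q$p) (f (gns_inv B \<Lambda> (axis p 1)) (gns_inv B \<Lambda> (axis q 1))))"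

definition Psi ::
    "(complex^'n^'n) set \<Rightarrow> (complex^'n^'n \<Rightarrow> complex^'l) \<Rightarrow> complex^'n^'n \<Rightarrow>
     complex^'l^'l \<Rightarrow> complex^('n \<times> 'n)^('n \<times> 'n)"
  where "Psi B \<Lambda> Q = theta_extend B \<Lambda> (\<lambda>a b. kron (cadj a) (modular Q (\<i> / 2) b))"

definition Psi' ::
    "(complex^'n^'n) set \<Rightarrow> (complex^'n^'n \<Rightarrow> complex^'l) \<Rightarrow> complex^'n^'n \<Rightarrow>
     complex^'l^'l \<Rightarrow> complex^('n \<times> 'n)^('n \<times> 'n)"
  where "Psi' B \<Lambda> Q = theta_extend B \<Lambda> (\<lambda>a b. kron (modular Q (\<i> / 2) b) (cadj a))"

section \<open>The algebra \<open>B \<otimes> B\<^sup>o\<^sup>p\<close>\<close>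

text \<open>
  As a *-vector space, \<open>B \<otimes> B\<^sup>o\<^sup>p\<close> is the span of the \<open>kron a b\<close> with \<open>a, b \<in> B\<close>, with
  involution \<open>cadj\<close>; its product is not \<open>**\<close> but \<open>op_mult\<close>.  The conjugate space of
  \<open>complex^'n\<close> is identified with \<open>complex^'n\<close> by conjugating coordinates, which turns
  \<open>x\<^sup>\<top>\<close> into the transposed matrix, so that \<open>op_act x\<close> (the partial transpose in the second
  tensor factor) is the operator by which \<open>x\<close> acts on the tensor product of \<open>H\<close> and its
  conjugate.
\<close>

definition tensor_alg :: "(complex^'n^'n) set \<Rightarrow> (complex^('n \<times> 'n)^('n \<times> 'n)) set" where
  "tensor_alg B = cmat.span {kron a b | a b. a \<in> B \<and> b \<in> B}"

definition op_mult ::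
    "complex^('n::finite \<times> 'n)^('n \<times> 'n) \<Rightarrow> complex^('n \<times> 'n)^('n \<times> 'n) \<Rightarrow> complex^('n \<times> 'n)^('n \<times> 'n)"
  where "op_mult x y =
    (\<chi> i k. \<Sum>p\<in>UNIV. \<Sum>q\<in>UNIV. x $ (fst i, q) $ (p, snd k) * y $ (p, snd i) $ (fst k, q))"

definition op_act :: "complex^('n::finite \<times> 'n)^('n \<times> 'n) \<Rightarrow> complex^('n \<times> 'n)^('n \<times> 'n)" where
  "op_act x = (\<chi> i k. x $ (fst i, snd k) $ (fst k, snd i))"

definition swap :: "complex^('n::finite \<times> 'n)^('n \<times> 'n) \<Rightarrow> complex^('n \<times> 'n)^('n \<times> 'n)" where
  "swap x = (\<chi> i k. x $ (snd i, fst i) $ (snd k, fst k))"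

definition mat_unit :: "'n \<Rightarrow> 'n \<Rightarrow> complex^'n^'n" where
  "mat_unit i j = (\<chi> p q. if p = i \<and> q = j then 1 else 0)"

definition tensor_map ::
    "(complex^'n^'n \<Rightarrow> complex^'n^'n) \<Rightarrow> (complex^'n^'n \<Rightarrow> complex^'n^'n) \<Rightarrow>
     complex^('n \<times> 'n)^('n \<times> 'n) \<Rightarrow> complex^('n \<times> 'n)^('n \<times> 'n)"
  where "tensor_map f g x = (\<Sum>i\<in>UNIV. \<Sum>k\<in>UNIV.
    cscale (x$i$k) (kron (f (mat_unit (fst i) (fst k))) (g (mat_unit (snd i) (snd k)))))"

section \<open>Operators as vectors\<close>

text \<open>
  With the above identification of the conjugate space, \<open>\<theta>\<^bsub>\<xi>,\<eta>\<^esub> \<mapsto> \<eta> \<otimes> cnj \<xi>\<close> rearranges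
  matrix entries; \<open>op_of_vec\<close> is its inverse.
\<close>

definition op_of_vec :: "complex^('n::finite \<times> 'n) \<Rightarrow> complex^'n^'n" where
  "op_of_vec v = (\<chi> i j. v $ (i, j))"

definition conj_vec :: "complex^'n \<Rightarrow> complex^'n" where
  "conj_vec v = (\<chi> i. cnj (v$i))"

definition J0 :: "complex^('n::finite \<times> 'n) \<Rightarrow> complex^('n \<times> 'n)" where
  "J0 v = (\<chi> i. cnj (v $ (snd i, fst i)))"

section \<open>The definitions above have their defining properties\<close>

lemma conj_vec_transpose: "transpose x *v conj_vec \<xi> = conj_vec (cadj x *v \<xi>)"
  by (simp add: conj_vec_def cadj_def transpose_def matrix_vector_mult_def vec_eq_iff)

lemma op_of_vec_tensor: "op_of_vec (tensor_vec \<eta> (conj_vec \<xi>)) = theta \<xi> \<eta>"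
  by (simp add: op_of_vec_def tensor_vec_def conj_vec_def theta_def vec_eq_iff)

lemma J0_tensor: "J0 (tensor_vec \<eta> (conj_vec \<xi>)) = tensor_vec \<xi> (conj_vec \<eta>)"
  by (simp add: J0_def tensor_vec_def conj_vec_def vec_eq_iff)

lemma op_act_kron: "op_act (kron a b) = kron a (transpose b)"
  by (simp add: op_act_def kron_def transpose_def vec_eq_iff)

lemma swap_kron: "swap (kron a b) = kron b a"
  by (simp add: swap_def kron_def vec_eq_iff)

lemma op_mult_kron: "op_mult (kron a b) (kron c d) = kron (a ** c) (d ** b)"
  by (simp add: op_mult_def kron_def matrix_matrix_mult_def vec_eq_iff sum_product mult_ac)
    (intro allI, rule sum.swap)

lemma op_act_op_mult: "op_act (op_mult x y) = op_act x ** op_act y"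
  by (simp add: op_act_def op_mult_def matrix_matrix_mult_def vec_eq_iff sum.cartesian_product
      case_prod_unfold)

lemma sum_mat_unit: "(\<Sum>i\<in>UNIV. \<Sum>j\<in>UNIV. cscale (a$i$j) (mat_unit i j)) = a"
proof -
  have "(\<Sum>i\<in>UNIV. \<Sum>j\<in>UNIV. cscale (a$i$j) (mat_unit i j)) $ p $ q = a $ p $ q" for p q
  proof -
    have "cscale (a$i$j) (mat_unit i j) $ p $ q = (if q = j then if p = i then a$i$j else 0 else 0)"
      for i j by (simp add: cscale_def mat_unit_def)
    then show ?thesis by simp
  qed
  then show ?thesis by (simp add: vec_eq_iff)
qed

lemma cscale_nth: "cscale c A $ i $ j = c * A $ i $ j"
  by (simp add: cscale_def)

lemma clinear_on_UNIV_zero: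
  assumes "clinear_on UNIV cscale cscale f"
  shows "f 0 = 0"
proof -
  have "f (0 + 0) = f 0 + f 0" using assms unfolding clinear_on_def by blast
  then show ?thesis by simp
qed

lemma clinear_on_UNIV_sum:
  assumes "clinear_on UNIV cscale cscale f" "finite I"
  shows "f (\<Sum>i\<in>I. g i) = (\<Sum>i\<in>I. f (g i))"
  using assms(2)
  by induction (use assms(1) clinear_on_UNIV_zero[OF assms(1)] in \<open>simp_all add: clinear_on_def\<close>)

lemma clinear_on_UNIV_expand:
  assumes "clinear_on UNIV cscale cscale f"
  shows "(\<Sum>i\<in>UNIV. \<Sum>j\<in>UNIV. cscale (a$i$j) (f (mat_unit i j))) = f a"
proof -
  have "f a = f (\<Sum>i\<in>UNIV. \<Sum>j\<in>UNIV. cscale (a$i$j) (mat_unit i j))"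
    by (simp only: sum_mat_unit)
  also have "\<dots> = (\<Sum>i\<in>UNIV. \<Sum>j\<in>UNIV. cscale (a$i$j) (f (mat_unit i j)))"
    using assms by (simp add: clinear_on_UNIV_sum) (simp add: clinear_on_def)
  finally show ?thesis ..
qed

lemma sum_UNIV_prod:
  fixes h :: "'a::finite \<times> 'b::finite \<Rightarrow> 'c::comm_monoid_add"
  shows "(\<Sum>x\<in>UNIV. h x) = (\<Sum>i\<in>UNIV. \<Sum>j\<in>UNIV. h (i, j))"
  by (simp add: sum.cartesian_product)

lemma tensor_map_kron:
  assumes f: "clinear_on UNIV cscale cscale f" and g: "clinear_on UNIV cscale cscale g"
  shows "tensor_map f g (kron a b) = kron (f a) (g b)"
proof -
  have "tensor_map f g (kron a b) $ r $ s = kron (f a) (g b) $ r $ s" for r s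
  proof -
    have "kron (f a) (g b) $ r $ s =
      (\<Sum>i\<in>UNIV. \<Sum>j\<in>UNIV. cscale (a$i$j) (f (mat_unit i j))) $ fst r $ fst s *
      (\<Sum>i\<in>UNIV. \<Sum>j\<in>UNIV. cscale (b$i$j) (g (mat_unit i j))) $ snd r $ snd s"
      by (simp add: clinear_on_UNIV_expand[OF f] clinear_on_UNIV_expand[OF g] kron_def)
    also have "\<dots> = (\<Sum>i\<in>UNIV. \<Sum>i'\<in>UNIV. \<Sum>k\<in>UNIV. \<Sum>k'\<in>UNIV.
        a$i$k * f (mat_unit i k) $ fst r $ fst s * (b$i'$k' * g (mat_unit i' k') $ snd r $ snd s))"
      by (simp add: cscale_nth sum_product)
    also have "\<dots> = tensor_map f g (kron a b) $ r $ s"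
      by (simp add: tensor_map_def cscale_nth kron_def sum_UNIV_prod mult_ac)
    finally show ?thesis ..
  qed
  then show ?thesis by (simp add: vec_eq_iff)
qed

lemma modular_linear: "clinear_on UNIV cscale cscale (modular Q z)"
proof -
  have 1: "A ** cscale c B ** C = cscale c (A ** B ** C)" for A B C :: "complex^'a^'a" and c
    by (simp add: vec_eq_iff matrix_matrix_mult_def cscale_def sum_distrib_left sum_distrib_right mult_ac)
  have 2: "A ** (B + B') ** C = A ** B ** C + A ** B' ** C" for A B B' C :: "complex^'a^'a"
    by (simp add: vec_eq_iff matrix_matrix_mult_def sum.distrib algebra_simps)
  show ?thesis
    unfolding clinear_on_def modular_def by (simp add: 1 2)
qed

lemma clinear_on_sum:
  assumes X: "cmat.subspace X" and f: "clinear_on X cscale s f" and I: "finite I"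
    and g: "\<And>i. i \<in> I \<Longrightarrow> g i \<in> X"
  shows "f (\<Sum>i\<in>I. cscale (c i) (g i)) = (\<Sum>i\<in>I. s (c i) (f (g i)))"
proof -
  have zero: "f 0 = 0"
  proof -
    have "f (0 + 0) = f 0 + f 0"
      using f cmat.subspace_0[OF X] unfolding clinear_on_def by blast
    then show ?thesis by simp
  qed
  show ?thesis
    using I g
  proof induction
    case empty
    then show ?case using zero by simp
  next
    case (insert x F)
    have "(\<Sum>i\<in>F. cscale (c i) (g i)) \<in> X"
      using insert by (intro cmat.subspace_sum[OF X] cmat.subspace_scale[OF X]) simp
    moreover have "cscale (c x) (g x) \<in> X"
      using insert by (intro cmat.subspace_scale[OF X]) simp
    ultimately show ?case
      using insert f by (simp add: clinear_on_def)
  qed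
qed

lemma gns_inv_in:
  assumes "bij_betw \<Lambda> B UNIV" shows "gns_inv B \<Lambda> v \<in> B"
  using assms by (simp add: bij_betw_def inv_into_into)

lemma gns_expand:
  assumes B: "cmat.subspace B" and G: "gns_map B \<psi> \<Lambda>" and a: "a \<in> B"
  shows "(\<Sum>p\<in>UNIV. cscale (\<Lambda> a $ p) (gns_inv B \<Lambda> (axis p 1))) = a"
proof -
  have L: "clinear_on B cscale (*s) \<Lambda>" and bij: "bij_betw \<Lambda> B UNIV"
    using G by (auto simp: gns_map_def)
  have Li: "\<Lambda> (gns_inv B \<Lambda> v) = v" for v
    using bij by (simp add: bij_betw_def f_inv_into_f)
  have "\<Lambda> (\<Sum>p\<in>UNIV. cscale (\<Lambda> a $ p) (gns_inv B \<Lambda> (axis p 1))) = \<Lambda> a"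
    by (simp add: clinear_on_sum[OF B L] gns_inv_in[OF bij] Li basis_expansion)
  moreover have "(\<Sum>p\<in>UNIV. cscale (\<Lambda> a $ p) (gns_inv B \<Lambda> (axis p 1))) \<in> B"
    by (intro cmat.subspace_sum[OF B] cmat.subspace_scale[OF B] gns_inv_in[OF bij])
  ultimately show ?thesis
    using bij a by (metis bij_betw_def inj_onD)
qed

lemma gns_mult_tensor:
  assumes B: "unital_star_subalgebra B" and G: "gns_map B \<psi> \<Lambda>" and a: "a \<in> B" and b: "b \<in> B"
  shows "gns_mult B \<Lambda> *v tensor_vec (\<Lambda> a) (\<Lambda> b) = \<Lambda> (a ** b)"
proof -
  let ?x = "\<lambda>p. gns_inv B \<Lambda> (axis p 1)"
  have S: "cmat.subspace B" and mB: "\<And>a b. a \<in> B \<Longrightarrow> b \<in> B \<Longrightarrow> a ** b \<in> B"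
    using B by (auto simp: unital_star_subalgebra_def)
  have L: "clinear_on B cscale (*s) \<Lambda>" and bij: "bij_betw \<Lambda> B UNIV"
    using G by (auto simp: gns_map_def)
  have bilin: "(\<Sum>p\<in>I. cscale (c p) (x p)) ** (\<Sum>q\<in>J. cscale (d q) (y q))
      = (\<Sum>p\<in>I \<times> J. cscale (c (fst p) * d (snd p)) (x (fst p) ** y (snd p)))"
    if "finite I" "finite J" for I :: "'b set" and J :: "'b set" and c d
      and x y :: "'b \<Rightarrow> complex^'a^'a"
  proof -
    have "(\<Sum>p\<in>I. cscale (c p) (x p)) ** (\<Sum>q\<in>J. cscale (d q) (y q))
      = (\<Sum>p\<in>I. \<Sum>q\<in>J. cscale (c p * d q) (x p ** y q))" (is "?l = ?r")
    proof -
      have "?l $ i $ j = ?r $ i $ j" for i j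
      proof -
        have "?l $ i $ j = (\<Sum>k\<in>UNIV. \<Sum>p\<in>I. \<Sum>q\<in>J. c p * d q * (x p $ i $ k * y q $ k $ j))"
          by (simp add: matrix_matrix_mult_def cscale_nth sum_product mult_ac)
        also have "\<dots> = (\<Sum>p\<in>I. \<Sum>k\<in>UNIV. \<Sum>q\<in>J. c p * d q * (x p $ i $ k * y q $ k $ j))"
          by (rule sum.swap)
        also have "\<dots> = (\<Sum>p\<in>I. \<Sum>q\<in>J. \<Sum>k\<in>UNIV. c p * d q * (x p $ i $ k * y q $ k $ j))"
          by (intro sum.cong refl sum.swap)
        also have "\<dots> = ?r $ i $ j"
          by (simp add: matrix_matrix_mult_def cscale_nth sum_distrib_left)
        finally show ?thesis .
      qed
      then show ?thesis by (simp add: vec_eq_iff)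
    qed
    then show ?thesis by (simp add: sum.cartesian_product case_prod_unfold)
  qed
  have "a ** b = (\<Sum>p\<in>UNIV. cscale (\<Lambda> a $ fst p * \<Lambda> b $ snd p) (?x (fst p) ** ?x (snd p)))"
    using bilin[of UNIV UNIV "\<lambda>p. \<Lambda> a $ p" ?x "\<lambda>p. \<Lambda> b $ p" ?x] gns_expand[OF S G]
    by (simp add: a b)
  then have "\<Lambda> (a ** b) = (\<Sum>p\<in>UNIV. (\<Lambda> a $ fst p * \<Lambda> b $ snd p) *s \<Lambda> (?x (fst p) ** ?x (snd p)))"
    by (simp add: clinear_on_sum[OF S L] mB gns_inv_in[OF bij])
  then show ?thesis
    by (simp add: gns_mult_def tensor_vec_def matrix_vector_mult_def vec_eq_iff mult_ac)
qed

lemma theta_extend_linear: "clinear_on UNIV cscale cscale (theta_extend B \<Lambda> f)"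
  unfolding clinear_on_def theta_extend_def
  by (simp add: cmat.scale_left_distrib sum.distrib cmat.scale_sum_right cscale_nth)

lemma theta_extend_theta:
  assumes B: "cmat.subspace B" and G: "gns_map B \<psi> \<Lambda>" and a: "a \<in> B" and b: "b \<in> B"
    and f1: "\<And>b. b \<in> B \<Longrightarrow> clinear_on B cscale (\<lambda>c. cscale (cnj c)) (\<lambda>a. f a b)"
    and f2: "\<And>a. a \<in> B \<Longrightarrow> clinear_on B cscale cscale (f a)"
  shows "theta_extend B \<Lambda> f (theta (\<Lambda> a) (\<Lambda> b)) = f a b"
proof -
  let ?x = "\<lambda>p. gns_inv B \<Lambda> (axis p 1)"
  have bij: "bij_betw \<Lambda> B UNIV"
    using G by (auto simp: gns_map_def)
  note x = gns_inv_in[OF bij]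
  have "f a b = f (\<Sum>p\<in>UNIV. cscale (\<Lambda> a $ p) (?x p)) b"
    by (simp only: gns_expand[OF B G a])
  also have "\<dots> = (\<Sum>p\<in>UNIV. cscale (cnj (\<Lambda> a $ p)) (f (?x p) b))"
    by (rule clinear_on_sum[OF B f1[OF b]]) (simp_all add: x)
  also have "\<dots> = (\<Sum>p\<in>UNIV. cscale (cnj (\<Lambda> a $ p)) (f (?x p) (\<Sum>q\<in>UNIV. cscale (\<Lambda> b $ q) (?x q))))"
    by (simp only: gns_expand[OF B G b])
  also have "\<dots> = (\<Sum>p\<in>UNIV. cscale (cnj (\<Lambda> a $ p)) (\<Sum>q\<in>UNIV. cscale (\<Lambda> b $ q) (f (?x p) (?x q))))"
    by (simp add: clinear_on_sum[OF B f2] x)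
  also have "\<dots> = theta_extend B \<Lambda> f (theta (\<Lambda> a) (\<Lambda> b))"
    by (simp add: theta_extend_def theta_def cmat.scale_sum_right mult_ac)
  finally show ?thesis ..
qed

lemma Psi_theta:
  assumes "cmat.subspace B" "gns_map B \<psi> \<Lambda>" "a \<in> B" "b \<in> B"
  shows "Psi B \<Lambda> Q (theta (\<Lambda> a) (\<Lambda> b)) = kron (cadj a) (modular Q (\<i> / 2) b)"
    and "Psi' B \<Lambda> Q (theta (\<Lambda> a) (\<Lambda> b)) = kron (modular Q (\<i> / 2) b) (cadj a)"
proof -
  have m: "modular Q z (x + y) = modular Q z x + modular Q z y"
    "modular Q z (cscale c x) = cscale c (modular Q z x)" for z c x y
    using modular_linear[of Q z] by (auto simp: clinear_on_def)
  show "Psi B \<Lambda> Q (theta (\<Lambda> a) (\<Lambda> b)) = kron (cadj a) (modular Q (\<i> / 2) b)"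
    unfolding Psi_def
    by (rule theta_extend_theta[OF assms])
      (simp_all add: clinear_on_def m, simp_all add: vec_eq_iff kron_def cadj_def cscale_def algebra_simps)
  show "Psi' B \<Lambda> Q (theta (\<Lambda> a) (\<Lambda> b)) = kron (modular Q (\<i> / 2) b) (cadj a)"
    unfolding Psi'_def
    by (rule theta_extend_theta[OF assms])
      (simp_all add: clinear_on_def m, simp_all add: vec_eq_iff kron_def cadj_def cscale_def algebra_simps)
qed

section \<open>The four classes of objects\<close>

definition adjacency_ops_r ::
    "(complex^'n^'n) set \<Rightarrow> (complex^'n^'n \<Rightarrow> complex^'l) \<Rightarrow> (complex^'l^'l) set"
  where "adjacency_ops_r B \<Lambda> = {A. cadj A = A \<and>
    gns_mult B \<Lambda> ** kron A A ** cadj (gns_mult B \<Lambda>) = A \<and> transpose_r B \<Lambda> A = A}"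

definition adjacency_ops_l ::
    "(complex^'n^'n) set \<Rightarrow> (complex^'n^'n \<Rightarrow> complex^'l) \<Rightarrow> (complex^'l^'l) set"
  where "adjacency_ops_l B \<Lambda> = {A. cadj A = A \<and>
    gns_mult B \<Lambda> ** kron A A ** cadj (gns_mult B \<Lambda>) = A \<and> transpose_l B \<Lambda> A = A}"

definition invariant_projections ::
    "(complex^'n^'n) set \<Rightarrow> complex^'n^'n \<Rightarrow> (complex^('n \<times> 'n)^('n \<times> 'n)) set"
  where "invariant_projections B Q = {e \<in> tensor_alg B. cadj e = e \<and> op_mult e e = e \<and>
    e = swap e \<and> (\<forall>z. e = tensor_map (modular Q z) (modular Q z) e)}"

definition symmetric_invariant_subspaces ::
    "(complex^'n^'n) set \<Rightarrow> (complex^('n \<times> 'n)) set set"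
  where "symmetric_invariant_subspaces B = {V. vec.subspace V \<and>
    (\<forall>x\<in>tensor_alg (commutant B). \<forall>v\<in>V. op_act x *v v \<in> V) \<and> J0 ` V = V}"

definition selfadjoint_bimodules :: "(complex^'n^'n) set \<Rightarrow> (complex^'n^'n) set set" where
  "selfadjoint_bimodules B = {S. cmat.subspace S \<and>
    (\<forall>x\<in>commutant B. \<forall>y\<in>commutant B. \<forall>s\<in>S. x ** s ** y \<in> S) \<and> cadj ` S = S}"

end

theory Submission
  imports Defs
begin

text \<open>
  Writing \<open>s\<close> for \<open>\<sigma>\<^bsub>i/2\<^esub>\<close>, evaluation on the operators \<open>\<theta>\<^bsub>\<Lambda>(a),\<Lambda>(b)\<^esub>\<close> shows that \<open>\<Psi>\<close> turns
  \<open>A \<mapsto> m(A \<otimes> A)m\<^sup>*\<close> into \<open>e \<mapsto> e\<^sup>2\<close>, the adjoint into \<open>e \<mapsto> (s \<otimes> s)\<sigma>(e\<^sup>*)\<close>, and the two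
  transposes into \<open>e \<mapsto> (s \<otimes> s)\<^sup>\<plusminus>\<^sup>1\<sigma>(e)\<close>, which are mutually inverse.  So \<open>A\<close> satisfies the conditions
  iff \<open>e\<close> is a projection with \<open>e = e\<^sup>* = \<sigma>(e)\<close> and \<open>(s\<^sup>2 \<otimes> s\<^sup>2)(e) = e\<close>.  The last equation says that \<open>e\<close>
  commutes with the positive operator \<open>Q \<otimes> Q\<close>, hence with all of its complex powers; in terms of
  the image \<open>V\<close> of \<open>e\<close> it says that the hermitian operator \<open>Q \<otimes> (Q\<^sup>-\<^sup>1)\<^sup>\<top>\<close> preserves \<open>V\<close>.  Finally, an
  orthogonal projection has \<open>B' \<otimes> (B')\<^sup>o\<^sup>p\<close>-invariant image iff it commutes with that algebra, whose
  commutant is \<open>B \<otimes> B\<^sup>o\<^sup>p\<close> by the bicommutant theorem.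
\<close>

section \<open>Hermitian matrices and orthogonal projections\<close>

lemma cadj_cadj [simp]: "cadj (cadj A) = A"
  by (simp add: cadj_def vec_eq_iff)

lemma cadj_mult: "cadj (A ** B) = cadj B ** cadj A"
  by (simp add: cadj_def vec_eq_iff matrix_matrix_mult_def mult_ac)

lemma cadj_add: "cadj (A + B) = cadj A + cadj B"
  by (simp add: cadj_def vec_eq_iff)

lemma cadj_mat_1 [simp]: "cadj (mat 1) = mat 1"
  by (simp add: cadj_def mat_def vec_eq_iff)

lemma cadj_theta: "cadj (theta \<xi> \<eta>) = theta \<eta> \<xi>"
  by (simp add: cadj_def theta_def vec_eq_iff)

lemma cinner_commute: "cnj (cinner v w) = cinner w v"
  by (simp add: cinner_def mult_ac)

lemma cinner_add_right: "cinner v (w + w') = cinner v w + cinner v w'"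
  by (simp add: cinner_def algebra_simps sum.distrib)

lemma cinner_add_left: "cinner (v + v') w = cinner v w + cinner v' w"
  by (simp add: cinner_def algebra_simps sum.distrib)

lemma cinner_diff_right: "cinner v (w - w') = cinner v w - cinner v w'"
  by (simp add: cinner_def algebra_simps sum_subtractf)

lemma cinner_scale_right: "cinner v (c *s w) = c * cinner v w"
  by (simp add: cinner_def sum_distrib_left mult_ac)

lemma cinner_scale_left: "cinner (c *s v) w = cnj c * cinner v w"
  by (simp add: cinner_def sum_distrib_left mult_ac)

lemma cinner_zero [simp]: "cinner 0 v = 0" "cinner v 0 = 0"
  by (simp_all add: cinner_def)

lemma Re_cinner: "Re (cinner v w) = inner v w"
  by (simp add: cinner_def inner_vec_def inner_complex_def)

lemma cinner_self: "cinner v v = of_real ((norm v)\<^sup>2)"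
  by (simp add: complex_eq_iff Re_cinner power2_norm_eq_inner) (simp add: cinner_def mult_ac)

lemma cinner_axis [simp]: "cinner (axis i 1) v = v $ i"
proof -
  have "cnj (axis i 1 $ k) * v $ k = (if k = i then v $ k else 0)" for k
    by (simp add: axis_def)
  then show ?thesis by (simp add: cinner_def)
qed

lemma cinner_mult: "cinner (A *v v) w = cinner v (cadj A *v w)"
  using cinner_cadj[of "cadj A" v w] by simp

lemma scaleR_eq_smult: "r *\<^sub>R v = (of_real r :: complex) *s v"
  by (simp add: vec_eq_iff) (simp add: scaleR_conv_of_real)

text \<open>\<open>positive_op\<close> asks for a real nonnegative quadratic form; over the complex
  numbers, polarisation then forces self-adjointness.\<close>

lemma positive_op_hermitian:
  assumes "positive_op A" shows "cadj A = A"
proof -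
  have real: "cinner (A *v v) v = cinner v (A *v v)" for v
    using assms cinner_commute[of v "A *v v"]
    by (metis Reals_cnj_iff nonneg_Reals_subset_Reals positive_op_def subsetD)
  have pol: "cinner (A *v v) w + cinner (A *v w) v = cinner v (A *v w) + cinner w (A *v v)" for v w
    using real[of "v + w"] real[of v] real[of w]
    by (simp add: cinner_add_left cinner_add_right matrix_vector_right_distrib add_ac)
  have "cinner (A *v v) w = cinner v (A *v w)" for v w
  proof -
    \<comment> \<open>Polarisation at \<open>v\<close> and \<open>\<i> *s w\<close> controls the
      difference of the terms whose sum \<open>pol\<close> controls; adding the two relations
      isolates one term.\<close>
    have "\<i> * cinner (A *v v) w - \<i> * cinner (A *v w) v = \<i> * cinner v (A *v w) - \<i> * cinner w (A *v v)"
      using pol[of v "\<i> *s w"]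
      by (simp add: cinner_scale_left cinner_scale_right vector_scalar_commute)
    then have "cinner (A *v v) w - cinner (A *v w) v = cinner v (A *v w) - cinner w (A *v v)"
      by (simp flip: right_diff_distrib)
    with pol[of v w] have "2 * cinner (A *v v) w = 2 * cinner v (A *v w)" by algebra
    then show ?thesis by simp
  qed
  then have "cinner v (cadj A *v w) = cinner v (A *v w)" for v w
    by (simp add: cinner_mult)
  then have "cadj A *v w = A *v w" for w
    by (metis cinner_axis vec_eq_iff)
  then show ?thesis
    by (simp add: matrix_eq)
qed

section \<open>The spectral theorem on an invariant subspace, and orthogonal projections\<close>

lemma vec_subspaceD:
  fixes W :: "(complex^'n) set"
  assumes "vec.subspace W"
  shows "0 \<in> W" "x \<in> W \<Longrightarrow> y \<in> W \<Longrightarrow> x + y \<in> W" "x \<in> W \<Longrightarrow> y \<in> W \<Longrightarrow> x - y \<in> W"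
    "x \<in> W \<Longrightarrow> c *s x \<in> W" "x \<in> W \<Longrightarrow> r *\<^sub>R x \<in> W"
  using assms by (auto simp: scaleR_eq_smult vec.subspace_0 vec.subspace_add vec.subspace_diff vec.subspace_scale)

text \<open>A unit vector maximising the quadratic form of \<open>A\<close> on the unit sphere of
  \<open>W\<close> is an eigenvector. Allowing a proper subspace \<open>W\<close> lets
  \<open>hermitian_eigenbasis\<close> pass to orthogonal complements.\<close>

lemma hermitian_eigenvector:
  fixes A :: "complex^'n^'n"
  assumes A: "cadj A = A" and W: "vec.subspace W" and inv: "\<And>w. w \<in> W \<Longrightarrow> A *v w \<in> W"
    and W0: "W \<noteq> {0}"
  obtains v \<mu> where "v \<in> W" "cinner v v = 1" "A *v v = of_real \<mu> *s v"
proof -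
  note W = vec_subspaceD[OF W]
  have RW: "subspace W"
    by (simp add: subspace_def W)
  define q where "q w = inner w (A *v w)" for w
  have sym: "inner v (A *v w) = inner w (A *v v)" for v w
    by (metis A Re_cinner cinner_mult inner_commute)
  have "compact (W \<inter> sphere 0 1)"
    using RW by (simp add: closed_Int_compact closed_subspace)
  moreover have "W \<inter> sphere 0 1 \<noteq> {}"
  proof -
    obtain w where "w \<in> W" "w \<noteq> 0" using W0 W(1) by blast
    then have "(1 / norm w) *\<^sub>R w \<in> W \<inter> sphere 0 1" by (simp add: W)
    then show ?thesis by blast
  qed
  moreover have "continuous_on (W \<inter> sphere 0 1) q"
    unfolding q_def by (intro continuous_intros linear_continuous_on) (simp add: matrix_vector_mul_bounded_linear)
  ultimately obtain v where v: "v \<in> W" "norm v = 1"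
    and max: "\<And>w. w \<in> W \<Longrightarrow> norm w = 1 \<Longrightarrow> q w \<le> q v"
    using continuous_attains_sup[of "W \<inter> sphere 0 1" q]
    by (metis (no_types, lifting) IntD1 IntD2 IntI mem_sphere_0)
  have Ascale: "A *v (r *\<^sub>R w) = r *\<^sub>R (A *v w)" for r w
    by (simp add: scaleR_eq_smult vector_scalar_commute)
  have bound: "q w \<le> q v * inner w w" if "w \<in> W" for w
  proof (cases "w = 0")
    case False
    have "q ((1 / norm w) *\<^sub>R w) \<le> q v"
      by (rule max) (use that False in \<open>simp_all add: W\<close>)
    moreover have "q ((1 / norm w) *\<^sub>R w) = q w / inner w w"
      by (simp add: q_def Ascale power2_norm_eq_inner flip: power2_eq_square)
    ultimately show ?thesis using False by (simp add: divide_le_eq)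
  qed (simp add: q_def)
  \<comment> \<open>Half the gradient at \<open>v\<close> of \<open>q v * inner w w - q w\<close>, a
    function of \<open>w\<close> that is nonnegative on \<open>W\<close> and vanishes at
    \<open>v\<close>. Invariance puts \<open>u\<close> in \<open>W\<close>, so \<open>v\<close> may
    be perturbed along it.\<close>
  define u where "u = q v *\<^sub>R v - A *v v"
  have u: "u \<in> W" by (simp add: u_def W v inv)
  have ineq: "0 \<le> 2 * t * inner u u + t\<^sup>2 * (q v * inner u u - q u)" for t
  proof -
    have "q (v + t *\<^sub>R u) \<le> q v * inner (v + t *\<^sub>R u) (v + t *\<^sub>R u)"
      by (rule bound) (simp add: W v u)
    moreover have "inner v v = 1" using v by (simp add: norm_eq_1)
    moreover have "q (v + t *\<^sub>R u) = q v + 2 * t * inner u (A *v v) + t\<^sup>2 * q u"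
      using sym[of v u]
      by (simp add: q_def matrix_vector_right_distrib Ascale inner_add_left inner_add_right power2_eq_square algebra_simps)
    moreover have "inner u (A *v v) = q v * inner u v - inner u u"
      by (subst (4) u_def) (simp add: inner_diff_right)
    moreover have "inner (v + t *\<^sub>R u) (v + t *\<^sub>R u) = inner v v + 2 * t * inner u v + t\<^sup>2 * inner u u"
      by (simp add: inner_add_left inner_add_right inner_commute power2_eq_square algebra_simps)
    ultimately have "q v + 2 * t * (q v * inner u v - inner u u) + t\<^sup>2 * q u
        \<le> q v * (1 + 2 * t * inner u v + t\<^sup>2 * inner u u)" by simp
    then show ?thesis by (simp add: algebra_simps)
  qed
  have "inner u u = 0"
  proof (rule ccontr)
    assume "inner u u \<noteq> 0"
    define a where "a = inner u u"
    define c where "c = q v * inner u u - q u"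
    have a: "a > 0" using \<open>inner u u \<noteq> 0\<close> by (simp add: a_def)
    have I: "0 \<le> 2 * t * a + t\<^sup>2 * c" for t
      using ineq[of t] by (simp add: a_def c_def)
    have c0: "c \<ge> 0" using bound[OF u] by (simp add: c_def)
    \<comment> \<open>With this negative step the linear term of \<open>I\<close> dominates the
      quadratic one; the summand \<open>1\<close> keeps the denominator positive when
      \<open>c = 0\<close>.\<close>
    define t where "t = - a / (c + 1)"
    have "t < 0" using a c0 by (simp add: t_def)
    moreover have "t * c \<ge> - a" using a c0 by (simp add: t_def field_simps)
    ultimately have "t * (2 * a + t * c) < 0" using a by (intro mult_neg_pos) simp_all
    then show False using I[of t] by (simp add: power2_eq_square algebra_simps)
  qed
  then have "A *v v = of_real (q v) *s v"
    by (simp add: u_def scaleR_eq_smult)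
  moreover have "cinner v v = 1" using v by (simp add: cinner_self)
  ultimately show ?thesis using that v by blast
qed

definition orthonormal :: "(complex^'n) set \<Rightarrow> bool" where
  "orthonormal E \<longleftrightarrow> finite E \<and> (\<forall>v\<in>E. \<forall>w\<in>E. cinner v w = (if v = w then 1 else 0))"

text \<open>Induction on the dimension: one eigenvector is split off, and its orthogonal complement
  in \<open>W\<close> is again invariant because \<open>A\<close> is hermitian.\<close>

lemma hermitian_eigenbasis:
  fixes A :: "complex^'n^'n"
  assumes A: "cadj A = A" and W: "vec.subspace W" and inv: "\<And>w. w \<in> W \<Longrightarrow> A *v w \<in> W"
  shows "\<exists>E\<subseteq>W. orthonormal E \<and> (\<forall>v\<in>E. \<exists>\<mu>. A *v v = of_real \<mu> *s v) \<and>
    (\<forall>w\<in>W. w = (\<Sum>v\<in>E. cinner v w *s v))"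
  using W inv
proof (induction "vec.dim W" arbitrary: W rule: less_induct)
  case less
  note W = vec_subspaceD[OF less.prems(1)]
  show ?case
  proof (cases "W = {0}")
    case True
    then show ?thesis by (intro exI[of _ "{}"]) (simp add: orthonormal_def)
  next
    case False
    obtain v \<mu> where v: "v \<in> W" "cinner v v = 1" "A *v v = of_real \<mu> *s v"
      using hermitian_eigenvector[OF A less.prems False] by blast
    define W' where "W' = {w \<in> W. cinner v w = 0}"
    have W': "vec.subspace W'"
      by (simp add: vec.subspace_def W'_def W cinner_add_right cinner_scale_right)
    have "W' \<subset> W" using v unfolding W'_def by force
    then have "vec.span W' \<subset> vec.span W"
      using W' less.prems(1) by (metis vec.span_eq_iff)
    then have "vec.dim W' < vec.dim W" by (rule vec.dim_psubset)
    moreover have "A *v w \<in> W'" if "w \<in> W'" for w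
    proof -
      have "cinner v (A *v w) = cinner (A *v v) w" by (simp add: A cinner_mult)
      also have "\<dots> = 0" using that by (simp add: v cinner_scale_left W'_def)
      finally show ?thesis using that less.prems(2) by (simp add: W'_def)
    qed
    ultimately obtain E where E: "E \<subseteq> W'" "orthonormal E" "\<forall>v\<in>E. \<exists>\<mu>. A *v v = of_real \<mu> *s v"
      and exp: "\<And>w. w \<in> W' \<Longrightarrow> w = (\<Sum>v\<in>E. cinner v w *s v)"
      using less.hyps[OF _ W'] by meson
    have vE: "cinner v w = 0" "cinner w v = 0" if "w \<in> E" for w
      using E(1) that cinner_commute[of v w] by (auto simp: W'_def)
    then have nv: "v \<notin> E" using v(2) by fastforce
    have "orthonormal (insert v E)"
      using E(2) v(2) vE nv by (auto simp: orthonormal_def)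
    moreover have "w = (\<Sum>u\<in>insert v E. cinner u w *s u)" if w: "w \<in> W" for w
    proof -
      define w' where "w' = w - cinner v w *s v"
      have "w' \<in> W'" by (simp add: w'_def W'_def W w v cinner_diff_right cinner_scale_right)
      then have "w' = (\<Sum>u\<in>E. cinner u w' *s u)" by (rule exp)
      also have "\<dots> = (\<Sum>u\<in>E. cinner u w *s u)"
        by (rule sum.cong) (simp_all add: w'_def cinner_diff_right cinner_scale_right vE)
      finally show ?thesis using E(2) nv by (simp add: orthonormal_def w'_def algebra_simps)
    qed
    ultimately show ?thesis
      using E v \<open>W' \<subset> W\<close> by (intro exI[of _ "insert v E"]) auto
  qed
qed

text \<open>The projection is the sum of \<open>theta v v\<close> over an orthonormal basis of
  \<open>V\<close>.\<close>

lemma orthogonal_projection_exists: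
  fixes V :: "(complex^'n) set"
  assumes V: "vec.subspace V"
  obtains P where "cadj P = P" "P ** P = P" "range (\<lambda>v. P *v v) = V"
proof -
  \<comment> \<open>Every subspace is invariant under the identity matrix, so an eigenbasis for it
    is just an orthonormal basis of \<open>V\<close>.\<close>
  obtain E where E: "E \<subseteq> V" "orthonormal E" and exp: "\<And>w. w \<in> V \<Longrightarrow> w = (\<Sum>v\<in>E. cinner v w *s v)"
    using hermitian_eigenbasis[of "mat 1" V] V by auto
  define P where "P = (\<Sum>v\<in>E. theta v v)"
  have P: "P *v w = (\<Sum>v\<in>E. cinner v w *s v)" for w
  proof -
    have "(\<Sum>v\<in>F. theta v v) *v w = (\<Sum>v\<in>F. cinner v w *s v)" for F
      by (induction F rule: infinite_finite_induct)
        (simp_all add: matrix_vector_mult_add_rdistrib theta_apply)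
    then show ?thesis by (simp add: P_def)
  qed
  have in_V: "P *v w \<in> V" for w
    unfolding P using E(1) by (intro vec.subspace_sum[OF V] vec.subspace_scale[OF V]) auto
  have id: "P *v w = w" if "w \<in> V" for w
    using exp[OF that] by (simp add: P)
  have "cadj P = P"
  proof -
    have "cadj (\<Sum>v\<in>F. theta v v) = (\<Sum>v\<in>F. theta v v)" for F
      by (induction F rule: infinite_finite_induct) (simp_all add: cadj_add cadj_theta, simp_all add: cadj_def vec_eq_iff)
    then show ?thesis by (simp add: P_def)
  qed
  moreover have "P ** P = P"
    by (simp add: matrix_eq id in_V flip: matrix_vector_mul_assoc)
  moreover have "range (\<lambda>v. P *v v) = V"
    using in_V id by (metis image_subset_iff rangeI subsetI subset_antisym)
  ultimately show ?thesis using that by blast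
qed

text \<open>Each projection is the identity on the common range, so \<open>P ** P' = P'\<close> and
  \<open>P' ** P = P\<close>; the adjoint of the second relation is
  \<open>P ** P' = P\<close>.\<close>

lemma orthogonal_projection_unique:
  fixes P P' :: "complex^'n^'n"
  assumes P: "cadj P = P" "P ** P = P" and P': "cadj P' = P'" "P' ** P' = P'"
    and range: "range (\<lambda>v. P *v v) = range (\<lambda>v. P' *v v)"
  shows "P = P'"
proof -
  have "P ** P' = P'"
  proof -
    have "P *v (P' *v v) = P' *v v" for v
      using P(2) range by (metis (no_types, lifting) imageE matrix_vector_mul_assoc rangeI)
    then show ?thesis by (simp add: matrix_eq flip: matrix_vector_mul_assoc)
  qed
  moreover have "P' ** P = P"
  proof -
    have "P' *v (P *v v) = P *v v" for v
      using P'(2) range by (metis (no_types, lifting) imageE matrix_vector_mul_assoc rangeI)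
    then show ?thesis by (simp add: matrix_eq flip: matrix_vector_mul_assoc)
  qed
  ultimately show ?thesis
    using cadj_mult[of P' P] P P' by simp
qed

section \<open>Unitary diagonalisation of positive matrices\<close>

definition diag :: "('n \<Rightarrow> complex) \<Rightarrow> complex^'n^'n" where
  "diag d = (\<chi> i j. if i = j then d i else 0)"

lemma diag_mult_left: "(diag d ** A) $ i $ j = d i * A $ i $ j"
  by (simp add: diag_def matrix_matrix_mult_def if_distrib[of "\<lambda>x. x * _"] cong: if_cong)

lemma diag_mult_right: "(A ** diag d) $ i $ j = A $ i $ j * d j"
  by (simp add: diag_def matrix_matrix_mult_def if_distrib[of "\<lambda>x. _ * x"] cong: if_cong)

text \<open>The columns of \<open>U\<close> form an orthonormal eigenbasis; positivity together with
  invertibility makes the eigenvalues strictly positive.\<close>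

lemma positive_diagonalisation:
  fixes A :: "complex^'n^'n"
  assumes pos: "positive_op A" and inv: "invertible A"
  obtains U :: "complex^'n^'n" and d :: "'n \<Rightarrow> real" where "U ** cadj U = mat 1" "cadj U ** U = mat 1" "\<And>i. d i > 0"
    "A = U ** diag (\<lambda>i. complex_of_real (d i)) ** cadj U"
proof -
  have A: "cadj A = A" using pos by (rule positive_op_hermitian)
  obtain E where E: "orthonormal E" "\<forall>v\<in>E. \<exists>\<mu>. A *v v = of_real \<mu> *s v"
    and exp: "\<And>w. w = (\<Sum>v\<in>E. cinner v w *s v)"
    using hermitian_eigenbasis[OF A vec.subspace_UNIV] by auto
  \<comment> \<open>Taking the trace of the resolution of the identity in two ways shows that
    \<open>E\<close> has as many elements as the index type, so its vectors can be the columns of a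
    square matrix.\<close>
  have "(of_nat (card E) :: complex) = (\<Sum>v\<in>E. cinner v v)"
    using E(1) by (simp add: orthonormal_def)
  also have "\<dots> = (\<Sum>v\<in>E. \<Sum>i\<in>UNIV. cinner v (axis i 1) * v $ i)"
  proof (rule sum.cong)
    fix v
    have "cinner v (axis i 1) = cnj (v $ i)" for i
      using cinner_commute[of "axis i 1" v] by simp
    then show "cinner v v = (\<Sum>i\<in>UNIV. cinner v (axis i 1) * v $ i)" by (simp add: cinner_def)
  qed simp
  also have "\<dots> = (\<Sum>i\<in>UNIV. \<Sum>v\<in>E. cinner v (axis i 1) * v $ i)"
    by (rule sum.swap)
  also have "\<dots> = (\<Sum>i\<in>(UNIV :: 'n set). (axis i 1 :: complex^'n) $ i)"
  proof (rule sum.cong)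
    fix i
    show "(\<Sum>v\<in>E. cinner v (axis i 1) * v $ i) = axis i 1 $ i"
      using arg_cong[OF exp[of "axis i 1"], of "\<lambda>w. w $ i"] by (simp add: sum_component)
  qed simp
  also have "\<dots> = of_nat CARD('n)" by (simp add: axis_def)
  finally have "card (UNIV :: 'n set) = card E" by (metis of_nat_eq_iff)
  moreover have finE: "finite E" using E(1) by (simp add: orthonormal_def)
  ultimately obtain f where f: "bij_betw f (UNIV :: 'n set) E"
    using finite_same_card_bij[of "UNIV :: 'n set" E] by auto
  define U where "U = (\<chi> i j. f j $ i)"
  have fE: "f i \<in> E" for i using f by (auto simp: bij_betw_def)
  have inj: "f i = f j \<longleftrightarrow> i = j" for i j using f by (auto simp: bij_betw_def inj_on_def)
  have "(cadj U ** U) $ i $ j = cinner (f i) (f j)" for i j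
    by (simp add: U_def cadj_def matrix_matrix_mult_def cinner_def)
  then have UU: "cadj U ** U = mat 1"
    using E(1) fE by (simp add: vec_eq_iff[where x = "_ ** _"] vec_eq_iff[where x = "_ $ _"] mat_def orthonormal_def inj)
  have UU': "U ** cadj U = mat 1" using UU matrix_left_right_inverse by blast
  have "\<exists>\<mu>. A *v f i = of_real \<mu> *s f i" for i using E(2) fE by blast
  then obtain d where d: "\<And>i. A *v f i = of_real (d i) *s f i" by metis
  have norm1: "cinner (f i) (f i) = 1" for i using E(1) fE by (simp add: orthonormal_def)
  have "d i > 0" for i
  proof -
    have "cinner (f i) (A *v f i) = of_real (d i)" by (simp add: d cinner_scale_right norm1)
    then have "complex_of_real (d i) \<in> \<real>\<^sub>\<ge>\<^sub>0" using pos by (metis positive_op_def)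
    then have "d i \<ge> 0" by simp
    moreover have "d i \<noteq> 0"
    proof
      assume "d i = 0"
      then have "A *v f i = 0" by (simp add: d)
      then have "f i = 0" using inv by (metis invertible_def matrix_vector_mul_assoc matrix_vector_mul_lid matrix_vector_mult_0_right)
      then show False using norm1[of i] by simp
    qed
    ultimately show ?thesis by simp
  qed
  moreover have "A ** U = U ** diag (\<lambda>i. of_real (d i))"
  proof -
    have "(A ** U) $ i $ j = (A *v f j) $ i" for i j
      by (simp add: U_def matrix_matrix_mult_def matrix_vector_mult_def)
    then show ?thesis by (simp add: vec_eq_iff diag_mult_right d) (simp add: U_def mult_ac)
  qed
  then have "A = U ** diag (\<lambda>i. of_real (d i)) ** cadj U"
    by (metis UU' matrix_mul_assoc matrix_mul_rid)
  ultimately show ?thesis using UU UU' by (intro that[of U d])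
qed

section \<open>Complex powers of a positive matrix\<close>

lemma cscale_mult_left: "cscale c A ** B = cscale c (A ** B)"
  by (simp add: vec_eq_iff matrix_matrix_mult_def cscale_def sum_distrib_left mult_ac)

lemma cscale_mult_right: "A ** cscale c B = cscale c (A ** B)"
  by (simp add: vec_eq_iff matrix_matrix_mult_def cscale_def sum_distrib_left mult_ac)

lemma matrix_add_mult_left: "(A + B) ** C = A ** C + B ** (C :: 'a::semiring_1^'m^'n)"
  by (simp add: vec_eq_iff matrix_matrix_mult_def sum.distrib algebra_simps)

lemma kron_add_left: "kron (A + A') B = kron A B + kron A' B"
  by (simp add: kron_def vec_eq_iff algebra_simps)

lemma kron_add_right: "kron A (B + B') = kron A B + kron A B'"
  by (simp add: kron_def vec_eq_iff algebra_simps)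

lemma kron_cscale_left: "kron (cscale c A) B = cscale c (kron A B)"
  by (simp add: kron_def cscale_def vec_eq_iff)

lemma kron_one: "kron (mat 1) (mat 1) = mat 1"
  by (simp add: kron_def mat_def vec_eq_iff prod_eq_iff)

lemma cscale_mat_unit: "cscale c (mat_unit i j) = theta (axis j 1) (c *s axis i 1)"
  by (simp add: vec_eq_iff cscale_def mat_unit_def theta_def axis_def)

lemma kron_mat_unit: "kron (mat_unit i j) (mat_unit k l) = mat_unit (i, k) (j, l)"
  by (simp add: vec_eq_iff kron_def mat_unit_def prod_eq_iff)

text \<open>Additivity suffices because the matrix entries are absorbed into the second vector of
  \<open>theta\<close>. Antilinear maps, such as those involving \<open>cadj\<close>, can thus be
  compared in the same way.\<close>

lemma additive_eq_on_theta:
  fixes f g :: "complex^'n^'n \<Rightarrow> 'b::ab_group_add"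
  assumes f: "Modules.additive f" and g: "Modules.additive g" and eq: "\<And>v w. f (theta v w) = g (theta v w)"
  shows "f A = g A"
proof -
  have "h A = (\<Sum>i\<in>UNIV. \<Sum>j\<in>UNIV. h (theta (axis j 1) (A $ i $ j *s axis i 1)))" if "Modules.additive h"
    for h :: "complex^'n^'n \<Rightarrow> 'b"
    by (subst (1) sum_mat_unit[symmetric]) (simp add: Modules.additive.sum[OF that] cscale_mat_unit)
  from this[OF f] this[OF g] show ?thesis by (simp add: eq)
qed

text \<open>The same device, with the matrix entries absorbed into the first tensor factor.\<close>

lemma additive_eq_on_kron:
  fixes f g :: "complex^('n::finite \<times> 'm::finite)^('n \<times> 'm) \<Rightarrow> 'b::ab_group_add"
  assumes f: "Modules.additive f" and g: "Modules.additive g" and eq: "\<And>a b. f (kron a b) = g (kron a b)"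
  shows "f x = g x"
proof -
  have "h x = (\<Sum>i\<in>UNIV. \<Sum>k\<in>UNIV. h (kron (cscale (x $ i $ k) (mat_unit (fst i) (fst k)))
      (mat_unit (snd i) (snd k))))" if "Modules.additive h"
    for h :: "complex^('n \<times> 'm)^('n \<times> 'm) \<Rightarrow> 'b"
    by (subst (1) sum_mat_unit[symmetric])
      (simp add: Modules.additive.sum[OF that] kron_cscale_left kron_mat_unit)
  from this[OF f] this[OF g] show ?thesis by (simp add: eq)
qed

lemma conjugate_mult:
  assumes "U' ** U = mat 1"
  shows "(U ** A ** U') ** (U ** B ** U') = U ** (A ** B) ** (U' :: complex^'n^'n)"
  by (metis assms matrix_mul_assoc matrix_mul_rid)

text \<open>In the eigenbasis \<open>X\<close> becomes \<open>Y\<close>, and commuting with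
  \<open>diag d\<close> means that \<open>Y $ i $ j\<close> vanishes unless
  \<open>d i = d j\<close>. In the latter case \<open>f i = f j\<close>, so \<open>Y\<close>
  commutes with \<open>diag f\<close>.\<close>

lemma commute_functional_calculus:
  fixes X U U' :: "complex^'n^'n"
  assumes U: "U ** U' = mat 1" "U' ** U = mat 1"
    and comm: "X ** (U ** diag d ** U') = (U ** diag d ** U') ** X"
    and f: "\<And>i j. d i = d j \<Longrightarrow> f i = f j"
  shows "X ** (U ** diag f ** U') = (U ** diag f ** U') ** X"
proof -
  define Y where "Y = U' ** X ** U"
  have X: "X = U ** Y ** U'"
    unfolding Y_def using U by (metis matrix_mul_assoc matrix_mul_lid matrix_mul_rid)
  have "U ** (Y ** diag d) ** U' = U ** (diag d ** Y) ** U'"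
    using comm by (simp add: X conjugate_mult U)
  then have "U' ** (U ** (Y ** diag d) ** U') ** U = U' ** (U ** (diag d ** Y) ** U') ** U" by simp
  then have "Y ** diag d = diag d ** Y"
    using U by (metis matrix_mul_assoc matrix_mul_lid matrix_mul_rid)
  then have "Y $ i $ j * d j = d i * Y $ i $ j" for i j
    by (metis diag_mult_left diag_mult_right)
  then have "Y $ i $ j = 0 \<or> f i = f j" for i j
    by (metis f mult.commute mult_cancel_left)
  then have "Y $ i $ j * f j = f i * Y $ i $ j" for i j
    by (metis mult.commute mult_zero_left)
  then have "Y ** diag f = diag f ** Y"
    by (simp add: vec_eq_iff diag_mult_left diag_mult_right)
  then show ?thesis by (simp add: X conjugate_mult U)
qed

lemma diag_mult: "diag f ** diag g = diag (\<lambda>i. f i * g i)"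
  by (simp add: vec_eq_iff diag_mult_left) (simp add: diag_def)

lemma kron_diag: "kron (diag f) (diag g) = diag (\<lambda>i. f (fst i) * g (snd i))"
  by (simp add: vec_eq_iff kron_def diag_def prod_eq_iff)

section \<open>Complex powers and the modular group\<close>

locale positive_invertible =
  fixes Q :: "complex^'n^'n"
  assumes pos: "positive_op Q" and inv: "invertible Q"
begin

text \<open>One diagonalisation computes all complex powers at once, so the exponent laws below
  reduce to those of \<open>powr\<close> with a positive base.\<close>

lemma cpow_diagonalisation:
  obtains U :: "complex^'n^'n" and d :: "'n \<Rightarrow> real"
  where "U ** cadj U = mat 1" "cadj U ** U = mat 1" "\<And>i. d i > 0"
    "Q = U ** diag (\<lambda>i. complex_of_real (d i)) ** cadj U"
    "\<And>w. mat_cpow Q w = U ** diag (\<lambda>i. of_real (d i) powr w) ** cadj U"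
proof -
  obtain U :: "complex^'n^'n" and d :: "'n \<Rightarrow> real"
    where U: "U ** cadj U = mat 1" "cadj U ** U = mat 1" and d: "\<And>i. d i > 0"
      and Q: "Q = U ** diag (\<lambda>i. complex_of_real (d i)) ** cadj U"
    using positive_diagonalisation[OF pos inv] by metis
  show ?thesis
    using U d Q mat_cpow_diagonalisable[OF U Q[unfolded diag_def]] by (intro that[of U d]) (simp_all add: diag_def)
qed

lemma cadj_Q: "cadj Q = Q"
  using pos by (rule positive_op_hermitian)

lemma cpow_add: "mat_cpow Q w ** mat_cpow Q w' = mat_cpow Q (w + w')"
proof (rule cpow_diagonalisation)
  fix U :: "complex^'n^'n" and d :: "'n \<Rightarrow> real"
  assume "cadj U ** U = mat 1"
    "\<And>w. mat_cpow Q w = U ** diag (\<lambda>i. of_real (d i) powr w) ** cadj U"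
  then show ?thesis by (simp add: conjugate_mult diag_mult powr_add)
qed

lemma cpow_0: "mat_cpow Q 0 = mat 1"
proof (rule cpow_diagonalisation)
  fix U :: "complex^'n^'n" and d :: "'n \<Rightarrow> real"
  assume "U ** cadj U = mat 1" "\<And>i. d i > 0"
    "\<And>w. mat_cpow Q w = U ** diag (\<lambda>i. of_real (d i) powr w) ** cadj U"
  moreover have "diag (\<lambda>i. 1) = (mat 1 :: complex^'n^'n)" by (simp add: diag_def mat_def)
  \<comment> \<open>Nonzero eigenvalues matter here, since \<open>0 powr 0\<close> is
    \<open>0\<close>.\<close>
  ultimately show ?thesis by (simp add: less_imp_neq[symmetric])
qed

lemma cpow_1: "mat_cpow Q 1 = Q"
proof (rule cpow_diagonalisation)
  fix U :: "complex^'n^'n" and d :: "'n \<Rightarrow> real"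
  assume "\<And>i. d i > 0" "Q = U ** diag (\<lambda>i. complex_of_real (d i)) ** cadj U"
    "\<And>w. mat_cpow Q w = U ** diag (\<lambda>i. of_real (d i) powr w) ** cadj U"
  then show ?thesis by simp
qed

lemma Q_inverse: "Q ** matrix_inv Q = mat 1" "matrix_inv Q ** Q = mat 1"
  using someI_ex[OF inv[unfolded invertible_def]] by (simp_all add: matrix_inv_def)

lemma cpow_uminus_1: "mat_cpow Q (- 1) = matrix_inv Q"
proof -
  have "mat_cpow Q (- 1) ** Q = mat 1"
    using cpow_add[of "- 1" 1] by (simp add: cpow_0 cpow_1)
  then show ?thesis by (metis Q_inverse(1) matrix_mul_assoc matrix_mul_lid matrix_mul_rid)
qed

lemma cadj_cpow: "cadj (mat_cpow Q w) = mat_cpow Q (cnj w)"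
proof (rule cpow_diagonalisation)
  fix U :: "complex^'n^'n" and d :: "'n \<Rightarrow> real"
  assume d: "\<And>i. d i > 0" and "\<And>w. mat_cpow Q w = U ** diag (\<lambda>i. of_real (d i) powr w) ** cadj U"
  \<comment> \<open>For a positive base the logarithm is real, so conjugation affects the exponent
    alone.\<close>
  moreover have "cnj (of_real (d i) powr w) = of_real (d i) powr (cnj w)" for i w
    using d[of i] by (simp add: powr_def Ln_of_real exp_cnj less_imp_neq[symmetric])
  then have "cadj (diag (\<lambda>i. of_real (d i) powr w)) = diag (\<lambda>i. of_real (d i) powr cnj w)"
    by (simp add: cadj_def diag_def vec_eq_iff)
  ultimately show ?thesis by (simp add: cadj_mult matrix_mul_assoc)
qed

lemma cpow_commute: "X ** Q = Q ** X \<Longrightarrow> X ** mat_cpow Q w = mat_cpow Q w ** X"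
proof (rule cpow_diagonalisation)
  fix U :: "complex^'n^'n" and d :: "'n \<Rightarrow> real"
  assume X: "X ** Q = Q ** X" and U: "U ** cadj U = mat 1" "cadj U ** U = mat 1"
    and Q: "Q = U ** diag (\<lambda>i. complex_of_real (d i)) ** cadj U"
    and cpow: "\<And>w. mat_cpow Q w = U ** diag (\<lambda>i. of_real (d i) powr w) ** cadj U"
  show ?thesis
    unfolding cpow
  proof (rule commute_functional_calculus[OF U])
    show "X ** (U ** diag (\<lambda>i. complex_of_real (d i)) ** cadj U) =
        (U ** diag (\<lambda>i. complex_of_real (d i)) ** cadj U) ** X"
      using X unfolding Q .
  qed simp
qed

text \<open>The eigenvalues of \<open>kron Q Q\<close> are products of two eigenvalues of
  \<open>Q\<close>, and for positive numbers the power of a product is the product of the powers. So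
  \<open>kron (mat_cpow Q w) (mat_cpow Q w)\<close> is a function of \<open>kron Q Q\<close>, and
  the functional calculus applies.\<close>

lemma kron_cpow_commute:
  "X ** kron Q Q = kron Q Q ** X \<Longrightarrow>
    X ** kron (mat_cpow Q w) (mat_cpow Q w) = kron (mat_cpow Q w) (mat_cpow Q w) ** X"
proof (rule cpow_diagonalisation)
  fix U :: "complex^'n^'n" and d :: "'n \<Rightarrow> real"
  assume X: "X ** kron Q Q = kron Q Q ** X"
    and U: "U ** cadj U = mat 1" "cadj U ** U = mat 1" and d: "\<And>i. d i > 0"
    and Q: "Q = U ** diag (\<lambda>i. complex_of_real (d i)) ** cadj U"
    and cpow: "\<And>w. mat_cpow Q w = U ** diag (\<lambda>i. of_real (d i) powr w) ** cadj U"
  define D where "D i = complex_of_real (d (fst i)) * of_real (d (snd i))" for i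
  have Dpow: "of_real (d (fst i)) powr w * of_real (d (snd i)) powr w = D i powr w" for i w
    unfolding D_def using d by (simp add: powr_times_real less_imp_le)
  have eq: "kron (U ** diag f ** cadj U) (U ** diag f ** cadj U)
      = kron U U ** diag (\<lambda>i. f (fst i) * f (snd i)) ** kron (cadj U) (cadj U)" for f
    by (simp add: kron_mult flip: kron_diag)
  have "X ** (kron U U ** diag (\<lambda>i. D i powr w) ** kron (cadj U) (cadj U))
      = kron U U ** diag (\<lambda>i. D i powr w) ** kron (cadj U) (cadj U) ** X"
  proof (rule commute_functional_calculus[where d = D])
    show "X ** (kron U U ** diag D ** kron (cadj U) (cadj U)) = kron U U ** diag D ** kron (cadj U) (cadj U) ** X"
      using X unfolding Q eq D_def .
  qed (simp_all add: kron_mult U kron_one)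
  then show ?thesis
    by (simp only: cpow eq Dpow)
qed

lemma cpow_add': "A ** mat_cpow Q w ** mat_cpow Q w' = A ** mat_cpow Q (w + w')"
  by (metis cpow_add matrix_mul_assoc)

lemma modular_modular: "modular Q z (modular Q w a) = modular Q (z + w) a"
  by (simp add: modular_def matrix_mul_assoc cpow_add cpow_add' algebra_simps)

lemma modular_0: "modular Q 0 a = a"
  by (simp add: modular_def cpow_0)

lemma modular_mult: "modular Q z (a ** b) = modular Q z a ** modular Q z b"
  by (simp add: modular_def matrix_mul_assoc cpow_add' cpow_0)

lemma cadj_modular: "cadj (modular Q z a) = modular Q (cnj z) (cadj a)"
  by (simp add: modular_def cadj_mult cadj_cpow matrix_mul_assoc)

text \<open>With respect to \<open>**\<close>, both legs are conjugated in the same direction, so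
  invariance of an element becomes a commutation relation with powers of \<open>Q\<close> on both
  legs.\<close>

lemma tensor_map_modular:
  "tensor_map (modular Q z) (modular Q z) x =
    kron (mat_cpow Q (\<i> * z)) (mat_cpow Q (\<i> * z)) ** x ** kron (mat_cpow Q (- \<i> * z)) (mat_cpow Q (- \<i> * z))"
proof (rule additive_eq_on_kron[where x = x])
  show "Modules.additive (tensor_map (modular Q z) (modular Q z))"
    by unfold_locales (simp add: tensor_map_def cmat.scale_left_distrib sum.distrib)
  show "Modules.additive (\<lambda>x. kron (mat_cpow Q (\<i> * z)) (mat_cpow Q (\<i> * z)) ** x **
      kron (mat_cpow Q (- \<i> * z)) (mat_cpow Q (- \<i> * z)))"
    by unfold_locales (simp add: matrix_add_ldistrib matrix_add_mult_left)
qed (simp only: tensor_map_kron modular_linear, simp add: modular_def kron_mult)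

end

section \<open>Commutants\<close>

text \<open>Invariance of the range under \<open>R\<close> and \<open>cadj R\<close> gives
  \<open>P ** R ** P = R ** P\<close> and \<open>P ** cadj R ** P = cadj R ** P\<close>. The adjoint
  of the second relation is \<open>P ** R ** P = P ** R\<close>.\<close>

lemma projection_commute:
  fixes P R :: "complex^'n^'n"
  assumes P: "cadj P = P" "P ** P = P"
    and R: "(\<lambda>v. R *v v) ` range (\<lambda>v. P *v v) \<subseteq> range (\<lambda>v. P *v v)"
    and R': "(\<lambda>v. cadj R *v v) ` range (\<lambda>v. P *v v) \<subseteq> range (\<lambda>v. P *v v)"
  shows "R ** P = P ** R"
proof -
  have "P ** (T ** P) = T ** P" if T: "(\<lambda>v. T *v v) ` range (\<lambda>v. P *v v) \<subseteq> range (\<lambda>v. P *v v)" for T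
  proof -
    have "P *v (T *v (P *v v)) = T *v (P *v v)" for v
    proof -
      obtain w where "T *v (P *v v) = P *v w" using T by blast
      then show ?thesis by (simp add: matrix_vector_mul_assoc P)
    qed
    then show ?thesis by (simp add: matrix_eq flip: matrix_vector_mul_assoc)
  qed
  from this[OF R] this[OF R'] have 1: "P ** (R ** P) = R ** P" and 2: "P ** (cadj R ** P) = cadj R ** P"
    by auto
  have "P ** R = cadj (cadj R ** P)" by (simp add: cadj_mult P)
  also have "\<dots> = cadj (P ** (cadj R ** P))" by (simp add: 2)
  also have "\<dots> = P ** R ** P" by (simp add: cadj_mult P)
  finally show ?thesis using 1 by (simp add: matrix_mul_assoc)
qed

lemma range_commute:
  assumes "R ** P = P ** (R :: complex^'n^'n)"
  shows "(\<lambda>v. R *v v) ` range (\<lambda>v. P *v v) \<subseteq> range (\<lambda>v. P *v v)"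
proof clarify
  fix v
  have "R *v (P *v v) = P *v (R *v v)" by (simp add: matrix_vector_mul_assoc assms)
  then show "R *v (P *v v) \<in> range (\<lambda>v. P *v v)" by blast
qed

lemma subspace_range: "vec.subspace (range (\<lambda>v. P *v v))" for P :: "complex^'n^'m"
  unfolding vec.subspace_def
proof (intro conjI ballI allI; clarify?)
  have "P *v 0 = 0" by simp
  then show "0 \<in> range (\<lambda>v. P *v v)" by (metis rangeI)
next
  fix v w
  have "P *v v + P *v w = P *v (v + w)" by (simp add: matrix_vector_right_distrib)
  then show "P *v v + P *v w \<in> range (\<lambda>v. P *v v)" by blast
next
  fix c v
  have "c *s (P *v v) = P *v (c *s v)" by (simp add: vector_scalar_commute)
  then show "c *s (P *v v) \<in> range (\<lambda>v. P *v v)" by blast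
qed

text \<open>Slices are the coefficients of \<open>T\<close> with respect to the matrix units of the
  other factor: \<open>T\<close> is the sum of the
  \<open>kron (slice_fst T j l) (mat_unit j l)\<close>.\<close>

definition slice_fst :: "complex^('n::finite \<times> 'm::finite)^('n \<times> 'm) \<Rightarrow> 'm \<Rightarrow> 'm \<Rightarrow> complex^'n^'n" where
  "slice_fst T j l = (\<chi> i k. T $ (i, j) $ (k, l))"

definition slice_snd :: "complex^('n::finite \<times> 'm::finite)^('n \<times> 'm) \<Rightarrow> 'n \<Rightarrow> 'n \<Rightarrow> complex^'m^'m" where
  "slice_snd T i k = (\<chi> j l. T $ (i, j) $ (k, l))"

text \<open>Multiplication by \<open>kron x (mat 1)\<close>, on either side, acts on each
  first-factor slice separately.\<close>

lemma kron_one_commute_iff: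
  "kron x (mat 1) ** T = T ** kron x (mat 1) \<longleftrightarrow> (\<forall>j l. x ** slice_fst T j l = slice_fst T j l ** x)"
proof -
  have 1: "(kron x (mat 1) ** T) $ (i, j) $ (k, l) = (x ** slice_fst T j l) $ i $ k" for i j k l
    by (simp add: kron_def mat_def slice_fst_def matrix_matrix_mult_def sum_UNIV_prod if_distrib[of "\<lambda>x. _ * x"]
      if_distrib[of "\<lambda>x. x * _"] cong: if_cong)
  have 2: "(T ** kron x (mat 1)) $ (i, j) $ (k, l) = (slice_fst T j l ** x) $ i $ k" for i j k l
    by (simp add: kron_def mat_def slice_fst_def matrix_matrix_mult_def sum_UNIV_prod if_distrib[of "\<lambda>x. _ * x"]
      cong: if_cong)
  show ?thesis
    by (simp add: vec_eq_iff 1 2) blast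
qed

lemma one_kron_commute_iff:
  "kron (mat 1) x ** T = T ** kron (mat 1) x \<longleftrightarrow> (\<forall>i k. x ** slice_snd T i k = slice_snd T i k ** x)"
proof -
  have 1: "(kron (mat 1) x ** T) $ (i, j) $ (k, l) = (x ** slice_snd T i k) $ j $ l" for i j k l
  proof -
    have "(kron (mat 1) x ** T) $ (i, j) $ (k, l) =
        (\<Sum>p\<in>UNIV. if i = p then (\<Sum>q\<in>UNIV. x $ j $ q * T $ (p, q) $ (k, l)) else 0)"
      by (auto simp: kron_def mat_def matrix_matrix_mult_def sum_UNIV_prod simp del: sum.delta sum.delta' intro!: sum.cong)
    then show ?thesis by (simp add: slice_snd_def matrix_matrix_mult_def)
  qed
  have 2: "(T ** kron (mat 1) x) $ (i, j) $ (k, l) = (slice_snd T i k ** x) $ j $ l" for i j k l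
  proof -
    have "(T ** kron (mat 1) x) $ (i, j) $ (k, l) =
        (\<Sum>p\<in>UNIV. if p = k then (\<Sum>q\<in>UNIV. T $ (i, j) $ (p, q) * x $ q $ l) else 0)"
      by (auto simp: kron_def mat_def matrix_matrix_mult_def sum_UNIV_prod simp del: sum.delta sum.delta' intro!: sum.cong)
    then show ?thesis by (simp add: slice_snd_def matrix_matrix_mult_def)
  qed
  show ?thesis
    by (simp add: vec_eq_iff 1 2) blast
qed

section \<open>Operators as vectors, and the bicommutant theorem\<close>

definition vec_of_op :: "complex^'n^'m \<Rightarrow> complex^('m::finite \<times> 'n::finite)" where
  "vec_of_op x = (\<chi> i. x $ fst i $ snd i)"

lemma vec_of_op_of_vec [simp]: "vec_of_op (op_of_vec v) = v"
  by (simp add: vec_of_op_def op_of_vec_def)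

lemma op_of_vec_of_op [simp]: "op_of_vec (vec_of_op x) = x"
  by (simp add: vec_of_op_def op_of_vec_def)

lemma op_of_vec_add: "op_of_vec (v + w) = op_of_vec v + op_of_vec w"
  by (simp add: op_of_vec_def vec_eq_iff)

lemma op_of_vec_scale: "op_of_vec (c *s v) = cscale c (op_of_vec v)"
  by (simp add: op_of_vec_def cscale_def vec_eq_iff)

text \<open>The dictionary between invariant subspaces and bimodules. With \<open>x = Q\<close> and
  \<open>y = matrix_inv Q\<close> it also translates the condition involving the weight.\<close>

lemma op_of_vec_kron: "op_of_vec (kron x (transpose y) *v v) = x ** op_of_vec v ** y"
proof -
  have "(\<Sum>k\<in>UNIV. x $ i $ fst k * y $ snd k $ j * v $ k)
    = (\<Sum>l\<in>UNIV. (\<Sum>k\<in>UNIV. x $ i $ k * v $ (k, l)) * y $ l $ j)" for i j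
    by (subst sum_UNIV_prod, subst sum.swap) (simp add: sum_distrib_right sum_distrib_left mult_ac)
  then show ?thesis
    by (simp add: op_of_vec_def kron_def transpose_def matrix_vector_mult_def matrix_matrix_mult_def vec_eq_iff)
qed

lemma op_of_vec_J0: "op_of_vec (J0 v) = cadj (op_of_vec v)"
  by (simp add: op_of_vec_def J0_def cadj_def vec_eq_iff)

lemma unital_star_subalgebraD:
  assumes "unital_star_subalgebra B"
  shows "cmat.subspace B" "mat 1 \<in> B" "a \<in> B \<Longrightarrow> b \<in> B \<Longrightarrow> a ** b \<in> B" "a \<in> B \<Longrightarrow> cadj a \<in> B"
    "a \<in> B \<Longrightarrow> cscale c a \<in> B" "a \<in> B \<Longrightarrow> b \<in> B \<Longrightarrow> a + b \<in> B" "0 \<in> B"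
  using assms by (auto simp: unital_star_subalgebra_def cmat.subspace_scale cmat.subspace_add cmat.subspace_0)

text \<open>\<open>P\<close> is the orthogonal projection of matrix space onto \<open>B\<close> for
  the Hilbert-Schmidt inner product. Left multiplications by elements of \<open>B\<close> and by
  their adjoints preserve \<open>B\<close>, so \<open>P\<close> commutes with them.\<close>

lemma projection_onto_subalgebra:
  fixes B :: "(complex^'n^'n) set"
  assumes B: "unital_star_subalgebra B"
  obtains P where "\<And>v. op_of_vec (P *v v) \<in> B" "\<And>y. y \<in> B \<Longrightarrow> P *v vec_of_op y = vec_of_op y"
    "\<And>b. b \<in> B \<Longrightarrow> kron b (mat 1) ** P = P ** kron b (mat 1)"
proof -
  note B = unital_star_subalgebraD[OF B]
  define V where "V = {v. op_of_vec v \<in> B}"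
  have "vec.subspace V"
    using B by (simp add: vec.subspace_def V_def op_of_vec_add op_of_vec_scale)
      (simp add: op_of_vec_def zero_vec_def)
  then obtain P where P: "cadj P = P" "P ** P = P" and range: "range (\<lambda>v. P *v v) = V"
    using orthogonal_projection_exists by blast
  have inv: "(\<lambda>v. kron b (mat 1) *v v) ` V \<subseteq> V" if "b \<in> B" for b
    using op_of_vec_kron[of b "mat 1"] that B by (auto simp: V_def)
  have "kron b (mat 1) ** P = P ** kron b (mat 1)" if "b \<in> B" for b
    using projection_commute[OF P] inv[OF that] inv[OF B(4)[OF that]] by (simp add: range cadj_kron)
  moreover have "op_of_vec (P *v v) \<in> B" for v
    using range by (auto simp: V_def)
  moreover have "P *v vec_of_op y = vec_of_op y" if "y \<in> B" for y
  proof -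
    have "vec_of_op y \<in> range (\<lambda>v. P *v v)" using that by (simp add: range) (simp add: V_def)
    then show ?thesis by (auto simp: matrix_vector_mul_assoc P)
  qed
  ultimately show ?thesis using that by blast
qed

text \<open>
  A bicommutant element \<open>x\<close> commutes with the entries of the projection of matrix space
  onto \<open>B\<close>, so that this projection maps \<open>x = x ** 1\<close> to \<open>x\<close>.
\<close>

lemma bicommutant:
  fixes B :: "(complex^'n^'n) set"
  assumes B: "unital_star_subalgebra B"
  shows "commutant (commutant B) = B"
proof
  show "B \<subseteq> commutant (commutant B)" by (auto simp: commutant_def)
  show "commutant (commutant B) \<subseteq> B"
  proof
    fix x assume x: "x \<in> commutant (commutant B)"
    obtain P where P: "\<And>v. op_of_vec (P *v v) \<in> B" "\<And>y. y \<in> B \<Longrightarrow> P *v vec_of_op y = vec_of_op y"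
      "\<And>b. b \<in> B \<Longrightarrow> kron b (mat 1) ** P = P ** kron b (mat 1)"
      using projection_onto_subalgebra[OF B] by metis
    have "slice_fst P j l \<in> commutant B" for j l
      using P(3) by (simp add: kron_one_commute_iff commutant_def)
    then have comm: "kron x (mat 1) ** P = P ** kron x (mat 1)"
      using x by (simp add: kron_one_commute_iff commutant_def)
    have x1: "vec_of_op x = kron x (mat 1) *v vec_of_op (mat 1)"
      using op_of_vec_kron[of x "mat 1" "vec_of_op (mat 1)"] by (metis matrix_mul_rid op_of_vec_of_op transpose_mat vec_of_op_of_vec)
    have "P *v vec_of_op x = kron x (mat 1) *v (P *v vec_of_op (mat 1))"
      by (simp add: x1 matrix_vector_mul_assoc comm)
    also have "\<dots> = vec_of_op x"
      using unital_star_subalgebraD[OF B] by (simp add: P(2) x1)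
    finally show "x \<in> B" using P(1)[of "vec_of_op x"] by simp
  qed
qed

section \<open>The tensor algebra as a commutant\<close>

lemma tensor_alg_subspace: "cmat.subspace (tensor_alg B)"
  by (simp add: tensor_alg_def)

lemma kron_in_tensor_alg: "a \<in> B \<Longrightarrow> b \<in> B \<Longrightarrow> kron a b \<in> tensor_alg B"
  unfolding tensor_alg_def by (rule cmat.span_base) blast

text \<open>The scalars of a linear combination are moved into the first factor, where
  \<open>B\<close> is closed under scaling; this leaves three cases.\<close>

lemma tensor_alg_induct [consumes 2, case_names zero add kron]:
  fixes B :: "(complex^'n^'n) set"
  assumes x: "x \<in> tensor_alg B" and B: "cmat.subspace B"
    and zero: "P 0" and add: "\<And>x y. P x \<Longrightarrow> P y \<Longrightarrow> P (x + y)"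
    and kron: "\<And>a b. a \<in> B \<Longrightarrow> b \<in> B \<Longrightarrow> P (kron a b)"
  shows "P x"
  using x unfolding tensor_alg_def
proof (induction rule: cmat.span_induct_alt)
  case (step c x y)
  then obtain a b where "x = kron a b" "a \<in> B" "b \<in> B" by blast
  then have "P (cscale c x)"
    using kron[of "cscale c a" b] by (simp add: kron_cscale_left cmat.subspace_scale[OF B])
  then show ?case using step add by blast
qed (rule zero)

text \<open>Let \<open>E\<close> be a linear projection of the matrices onto \<open>B\<close>. On
  either leg of \<open>T\<close> it acts slice by slice, so it fixes \<open>T\<close> on each leg
  and hence on both at once; but the values of \<open>tensor_map E E\<close> are combinations of
  elementary tensors over \<open>B\<close>.\<close>

lemma slices_in_tensor_alg:
  fixes B :: "(complex^'n^'n) set"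
  assumes B: "unital_star_subalgebra B"
    and fst: "\<And>j l. slice_fst T j l \<in> B" and snd: "\<And>i k. slice_snd T i k \<in> B"
  shows "T \<in> tensor_alg B"
proof -
  obtain P where P: "\<And>v. op_of_vec (P *v v) \<in> B" "\<And>y. y \<in> B \<Longrightarrow> P *v vec_of_op y = vec_of_op y"
    using projection_onto_subalgebra[OF B] by metis
  define E where "E y = op_of_vec (P *v vec_of_op y)" for y
  have E: "E y \<in> B" "y \<in> B \<Longrightarrow> E y = y" for y
    by (simp_all add: E_def P)
  have vadd: "vec_of_op (x + y) = vec_of_op x + vec_of_op y" and vscale: "vec_of_op (cscale c x) = c *s vec_of_op x"
    for x y :: "complex^'n^'n" and c
    by (simp_all add: vec_of_op_def cscale_def vec_eq_iff)
  have lin: "clinear_on UNIV cscale cscale E"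
    by (simp add: clinear_on_def E_def vadd vscale op_of_vec_add op_of_vec_scale matrix_vector_right_distrib vector_scalar_commute)
  have lin_id: "clinear_on UNIV cscale cscale (\<lambda>x. x)"
    by (simp add: clinear_on_def)
  have "tensor_map E (\<lambda>x. x) T $ (i, j) $ (k, l) = E (slice_fst T j l) $ i $ k" for i j k l
  proof -
    have "tensor_map E (\<lambda>x. x) T $ (i, j) $ (k, l) = (\<Sum>p\<in>UNIV. \<Sum>q\<in>UNIV. \<Sum>r\<in>UNIV. \<Sum>s\<in>UNIV.
       if j = q \<and> l = s then T $ (p, q) $ (r, s) * E (mat_unit p r) $ i $ k else 0)"
      by (simp add: tensor_map_def cscale_nth kron_def sum_UNIV_prod mat_unit_def if_distrib[of "\<lambda>x. _ * x"] cong: if_cong)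
    also have "\<dots> = (\<Sum>p\<in>UNIV. \<Sum>q\<in>UNIV. if j = q then \<Sum>r\<in>UNIV. \<Sum>s\<in>UNIV.
       if l = s then T $ (p, q) $ (r, s) * E (mat_unit p r) $ i $ k else 0 else 0)"
      by (intro sum.cong refl) auto
    also have "\<dots> = (\<Sum>p\<in>UNIV. \<Sum>r\<in>UNIV. cscale (slice_fst T j l $ p $ r) (E (mat_unit p r))) $ i $ k"
      by (simp add: cscale_nth slice_fst_def)
    finally show ?thesis by (simp add: clinear_on_UNIV_expand[OF lin])
  qed
  then have 1: "tensor_map E (\<lambda>x. x) T = T"
    by (simp add: E(2) fst vec_eq_iff) (simp add: slice_fst_def)
  have "tensor_map (\<lambda>x. x) E T $ (i, j) $ (k, l) = E (slice_snd T i k) $ j $ l" for i j k l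
  proof -
    have "tensor_map (\<lambda>x. x) E T $ (i, j) $ (k, l) = (\<Sum>p\<in>UNIV. \<Sum>q\<in>UNIV. \<Sum>r\<in>UNIV. \<Sum>s\<in>UNIV.
       if i = p \<and> k = r then T $ (p, q) $ (r, s) * E (mat_unit q s) $ j $ l else 0)"
      by (simp add: tensor_map_def cscale_nth kron_def sum_UNIV_prod mat_unit_def if_distrib[of "\<lambda>x. _ * x"]
        if_distrib[of "\<lambda>x. x * _"] cong: if_cong)
    also have "\<dots> = (\<Sum>p\<in>UNIV. if i = p then \<Sum>q\<in>UNIV. \<Sum>r\<in>UNIV. if k = r then \<Sum>s\<in>UNIV.
       T $ (p, q) $ (r, s) * E (mat_unit q s) $ j $ l else 0 else 0)"
      by (intro sum.cong refl) (auto simp del: sum.delta sum.delta' intro!: sum.cong)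
    also have "\<dots> = (\<Sum>q\<in>UNIV. \<Sum>s\<in>UNIV. cscale (slice_snd T i k $ q $ s) (E (mat_unit q s))) $ j $ l"
      by (simp add: cscale_nth slice_snd_def)
    finally show ?thesis by (simp add: clinear_on_UNIV_expand[OF lin])
  qed
  then have 2: "tensor_map (\<lambda>x. x) E T = T"
    by (simp add: E(2) snd vec_eq_iff) (simp add: slice_snd_def)
  have add: "Modules.additive (tensor_map f g)" for f g :: "complex^'n^'n \<Rightarrow> complex^'n^'n"
    by unfold_locales (simp add: tensor_map_def cmat.scale_left_distrib sum.distrib)
  have "tensor_map E E T = tensor_map E (\<lambda>x. x) (tensor_map (\<lambda>x. x) E T)"
  proof (rule additive_eq_on_kron[where x = T])
    show "Modules.additive (\<lambda>T. tensor_map E (\<lambda>x. x) (tensor_map (\<lambda>x. x) E T))"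
      using add unfolding Modules.additive_def by simp
  qed (simp_all only: add tensor_map_kron lin lin_id)
  then have "tensor_map E E T = T" by (simp add: 1 2)
  moreover have "tensor_map E E T \<in> tensor_alg B"
    unfolding tensor_map_def
    by (intro cmat.subspace_sum[OF tensor_alg_subspace] cmat.subspace_scale[OF tensor_alg_subspace]
        kron_in_tensor_alg E)
  ultimately show ?thesis by simp
qed

lemma op_act_op_act [simp]: "op_act (op_act x) = x"
  by (simp add: op_act_def vec_eq_iff)

text \<open>Taking one of \<open>x\<close>, \<open>y\<close> to be the identity shows that the
  slices of \<open>T\<close> commute with the commutant of \<open>B\<close>; the bicommutant
  theorem, used one leg at a time, puts them in \<open>B\<close>.\<close>

lemma commutant_tensor_alg:
  fixes B :: "(complex^'n^'n) set"
  assumes B: "unital_star_subalgebra B"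
    and comm: "\<And>x y. x \<in> commutant B \<Longrightarrow> y \<in> commutant B \<Longrightarrow> op_act (kron x y) ** op_act T = op_act T ** op_act (kron x y)"
  shows "T \<in> tensor_alg B"
proof (rule slices_in_tensor_alg[OF B])
  note bic = bicommutant[OF B]
  have one: "mat 1 \<in> commutant B" by (simp add: commutant_def)
  \<comment> \<open>The partial transpose merely permutes the first-factor slices but transposes the
    second-factor ones, which reverses the products in their commutation relation.\<close>
  have eq1: "slice_fst (op_act T) j l = slice_fst T l j" for j l
    by (simp add: slice_fst_def op_act_def vec_eq_iff)
  have eq2: "slice_snd (op_act T) i k = transpose (slice_snd T i k)" for i k
    by (simp add: slice_snd_def op_act_def transpose_def vec_eq_iff)
  fix j l
  have "x ** slice_fst T j l = slice_fst T j l ** x" if "x \<in> commutant B" for x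
    using comm[OF that one] by (simp add: op_act_kron kron_one_commute_iff eq1)
  then have "slice_fst T j l \<in> commutant (commutant B)" by (simp add: commutant_def[of "commutant B"])
  then show "slice_fst T j l \<in> B" by (simp add: bic)
  have "slice_snd T j l ** y = y ** slice_snd T j l" if "y \<in> commutant B" for y
    using comm[OF one that]
    by (simp add: op_act_kron one_kron_commute_iff eq2) (metis matrix_transpose_mul transpose_transpose)
  then have "slice_snd T j l \<in> commutant (commutant B)" by (simp add: commutant_def[of "commutant B"])
  then show "slice_snd T j l \<in> B" by (simp add: bic)
qed

section \<open>Projections, invariant subspaces and bimodules\<close>

lemma commutant_unital_star_subalgebra:
  fixes B :: "(complex^'n^'n) set"
  assumes B: "unital_star_subalgebra B"
  shows "unital_star_subalgebra (commutant B)"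
  unfolding unital_star_subalgebra_def
proof (intro conjI ballI)
  show "cmat.subspace (commutant B)"
    by (simp add: cmat.subspace_def commutant_def cscale_mult_left cscale_mult_right matrix_add_ldistrib matrix_add_mult_left)
  show "mat 1 \<in> commutant B" by (simp add: commutant_def)
  fix a assume a: "a \<in> commutant B"
  show "a ** b \<in> commutant B" if "b \<in> commutant B" for b
    using a that by (simp add: commutant_def) (metis matrix_mul_assoc)
  show "cadj a \<in> commutant B"
    using a unital_star_subalgebraD(4)[OF B] by (simp add: commutant_def) (metis cadj_cadj cadj_mult)
qed

section \<open>Calculus of \<open>op_act\<close>, \<open>swap\<close>, \<open>op_mult\<close> and
  \<open>J0\<close>\<close>

lemma op_act_add: "op_act (x + y) = op_act x + op_act y"
  by (simp add: op_act_def vec_eq_iff)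

lemma swap_add: "swap (x + y) = swap x + swap y"
  by (simp add: swap_def vec_eq_iff)

lemma swap_swap [simp]: "swap (swap x) = x"
  by (simp add: swap_def vec_eq_iff)

lemma op_act_zero [simp]: "op_act 0 = 0"
  by (simp add: op_act_def vec_eq_iff)

lemma cadj_op_act: "cadj (op_act x) = op_act (cadj x)"
  by (simp add: cadj_def op_act_def vec_eq_iff)

lemma cadj_swap: "cadj (swap x) = swap (cadj x)"
  by (simp add: cadj_def swap_def vec_eq_iff)

text \<open>\<open>J0\<close> exchanges the two factors and conjugates. For self-adjoint
  \<open>e\<close> this relates stability of the image under \<open>J0\<close> to symmetry of
  \<open>e\<close> under \<open>swap\<close>.\<close>

lemma J0_op_act: "J0 (op_act x *v v) = op_act (swap (cadj x)) *v J0 v"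
proof -
  have "J0 (op_act x *v v) $ (i, j) = (op_act (swap (cadj x)) *v J0 v) $ (i, j)" for i j
  proof -
    have "J0 (op_act x *v v) $ (i, j) = (\<Sum>k\<in>UNIV. \<Sum>l\<in>UNIV. cnj (x $ (j, l) $ (k, i) * v $ (k, l)))"
      by (simp add: J0_def op_act_def matrix_vector_mult_def sum_UNIV_prod)
    also have "\<dots> = (\<Sum>l\<in>UNIV. \<Sum>k\<in>UNIV. cnj (x $ (j, l) $ (k, i) * v $ (k, l)))"
      by (rule sum.swap)
    also have "\<dots> = (op_act (swap (cadj x)) *v J0 v) $ (i, j)"
      by (simp add: J0_def op_act_def swap_def cadj_def matrix_vector_mult_def sum_UNIV_prod)
    finally show ?thesis .
  qed
  then show ?thesis by (simp add: vec_eq_iff)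
qed

lemma op_mult_add_left: "op_mult (x + y) z = op_mult x z + op_mult y z"
  by (simp add: op_mult_def vec_eq_iff algebra_simps sum.distrib)

lemma op_mult_add_right: "op_mult z (x + y) = op_mult z x + op_mult z y"
  by (simp add: op_mult_def vec_eq_iff algebra_simps sum.distrib)

text \<open>Expresses the product through \<open>**\<close>; \<open>b\<close> ends up on the right
  because the second leg is an opposite algebra.\<close>

lemma op_mult_kron_left: "op_mult (kron a b) x = kron a (mat 1) ** x ** kron (mat 1) b"
proof (rule additive_eq_on_kron[where x = x])
  show "Modules.additive (op_mult (kron a b))"
    by unfold_locales (rule op_mult_add_right)
  show "Modules.additive (\<lambda>x. kron a (mat 1) ** x ** kron (mat 1) b)"
    by unfold_locales (simp add: matrix_add_ldistrib matrix_add_mult_left)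
qed (simp add: op_mult_kron kron_mult)

lemma op_mult_kron_right: "op_mult x (kron a b) = kron (mat 1) b ** x ** kron a (mat 1)"
proof (rule additive_eq_on_kron[where x = x])
  show "Modules.additive (\<lambda>x. op_mult x (kron a b))"
    by unfold_locales (rule op_mult_add_left)
  show "Modules.additive (\<lambda>x. kron (mat 1) b ** x ** kron a (mat 1))"
    by unfold_locales (simp add: matrix_add_ldistrib matrix_add_mult_left)
qed (simp add: op_mult_kron kron_mult)

text \<open>The easy half of the commutant statement, complementing
  \<open>commutant_tensor_alg\<close>; by bilinearity it is checked on elementary tensors.\<close>

lemma op_act_commute:
  fixes B :: "(complex^'n^'n) set"
  assumes B: "unital_star_subalgebra B" and x: "x \<in> tensor_alg (commutant B)" and e: "e \<in> tensor_alg B"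
  shows "op_act x ** op_act e = op_act e ** op_act x"
  using e unital_star_subalgebraD(1)[OF B]
proof (induction rule: tensor_alg_induct)
  case ab: (kron a b)
  from x unital_star_subalgebraD(1)[OF commutant_unital_star_subalgebra[OF B]]
  show ?case
  proof (induction rule: tensor_alg_induct)
    case (kron c d)
    with ab show ?case
      by (simp add: commutant_def op_mult_kron flip: op_act_op_mult)
  qed (simp_all add: op_act_add matrix_add_ldistrib matrix_add_mult_left)
qed (simp_all add: op_act_add matrix_add_ldistrib matrix_add_mult_left)

lemma J0_J0 [simp]: "J0 (J0 v) = v"
  by (simp add: J0_def vec_eq_iff)

lemma op_of_vec_inj: "inj op_of_vec"
  by (metis injI vec_of_op_of_vec)

lemmas op_of_vec_image_subset_iff = inj_image_subset_iff[OF op_of_vec_inj]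
lemmas op_of_vec_image_eq_iff = inj_image_eq_iff[OF op_of_vec_inj]

lemma op_of_vec_subspace_iff: "cmat.subspace (op_of_vec ` V) \<longleftrightarrow> vec.subspace V"
proof -
  have [simp]: "op_of_vec v \<in> op_of_vec ` V \<longleftrightarrow> v \<in> V" for v
    by (rule inj_image_mem_iff[OF op_of_vec_inj])
  have "op_of_vec 0 = (0 :: complex^'a^'a)" by (simp add: op_of_vec_def vec_eq_iff)
  then have "0 \<in> op_of_vec ` V \<longleftrightarrow> 0 \<in> V" by (metis \<open>\<And>v. op_of_vec v \<in> op_of_vec ` V \<longleftrightarrow> v \<in> V\<close>)
  then show ?thesis
    by (simp add: cmat.subspace_def vec.subspace_def flip: op_of_vec_add op_of_vec_scale)
qed

text \<open>Under \<open>op_of_vec\<close> the action of elementary tensors becomes two-sided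
  multiplication, and \<open>J0\<close> becomes \<open>cadj\<close>.\<close>

lemma bimodule_iff_symmetric_invariant:
  fixes B :: "(complex^'n^'n) set"
  assumes B: "unital_star_subalgebra B"
  shows "op_of_vec ` V \<in> selfadjoint_bimodules B \<longleftrightarrow> V \<in> symmetric_invariant_subspaces B"
proof -
  have mem [simp]: "op_of_vec v \<in> op_of_vec ` V \<longleftrightarrow> v \<in> V" for v
    by (rule inj_image_mem_iff[OF op_of_vec_inj])
  \<comment> \<open>The bimodule action sees elementary tensors; passing to all of
    \<open>tensor_alg\<close> uses that \<open>V\<close> is a subspace.\<close>
  have "(\<forall>x\<in>commutant B. \<forall>y\<in>commutant B. \<forall>s\<in>op_of_vec ` V. x ** s ** y \<in> op_of_vec ` V) \<longleftrightarrow>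
      (\<forall>x\<in>tensor_alg (commutant B). \<forall>v\<in>V. op_act x *v v \<in> V)" if V: "vec.subspace V"
  proof (intro iffI ballI)
    fix x v
    assume x: "x \<in> tensor_alg (commutant B)" and v: "v \<in> V"
      and bim: "\<forall>x\<in>commutant B. \<forall>y\<in>commutant B. \<forall>s\<in>op_of_vec ` V. x ** s ** y \<in> op_of_vec ` V"
    from x unital_star_subalgebraD(1)[OF commutant_unital_star_subalgebra[OF B]]
    show "op_act x *v v \<in> V"
    proof (induction rule: tensor_alg_induct)
      case (kron a b)
      then show ?case
        using bim v by (simp add: op_act_kron flip: op_of_vec_kron)
    qed (simp_all add: op_act_add matrix_vector_mult_add_rdistrib vec_subspaceD[OF V])
  next
    fix x y s
    assume xy: "x \<in> commutant B" "y \<in> commutant B" and s: "s \<in> op_of_vec ` V"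
      and inv: "\<forall>x\<in>tensor_alg (commutant B). \<forall>v\<in>V. op_act x *v v \<in> V"
    then obtain v where v: "v \<in> V" "s = op_of_vec v" by blast
    have "op_act (kron x y) *v v \<in> V" using inv v xy kron_in_tensor_alg by blast
    then show "x ** s ** y \<in> op_of_vec ` V"
      by (simp add: v op_act_kron flip: op_of_vec_kron)
  qed
  moreover have "cadj ` op_of_vec ` V = op_of_vec ` V \<longleftrightarrow> J0 ` V = V"
  proof -
    have "cadj ` op_of_vec ` V = op_of_vec ` J0 ` V"
      by (simp add: image_image op_of_vec_J0)
    then show ?thesis by (simp add: op_of_vec_image_eq_iff)
  qed
  ultimately show ?thesis
    by (auto simp: selfadjoint_bimodules_def symmetric_invariant_subspaces_def op_of_vec_subspace_iff)
qed

section \<open>Modular invariance and the weight operator\<close>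

context positive_invertible
begin

abbreviation modular2 :: "complex \<Rightarrow> complex^('n \<times> 'n)^('n \<times> 'n) \<Rightarrow> complex^('n \<times> 'n)^('n \<times> 'n)" where
  "modular2 z \<equiv> tensor_map (modular Q z) (modular Q z)"

lemma modular2_kron: "modular2 z (kron a b) = kron (modular Q z a) (modular Q z b)"
  by (simp add: tensor_map_kron modular_linear)

lemma modular2_additive: "Modules.additive (modular2 z)"
  by unfold_locales (simp add: tensor_map_def cmat.scale_left_distrib sum.distrib)

lemma modular2_add: "modular2 z (x + y) = modular2 z x + modular2 z y"
  using modular2_additive by (simp add: Modules.additive_def)

lemma modular2_modular2: "modular2 z (modular2 w x) = modular2 (z + w) x"
proof (rule additive_eq_on_kron[where x = x])
  show "Modules.additive (\<lambda>x. modular2 z (modular2 w x))"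
    by unfold_locales (simp add: modular2_add)
qed (simp_all add: modular2_additive modular2_kron modular_modular)

lemma modular2_0: "modular2 0 x = x"
proof (rule additive_eq_on_kron[where x = x])
  show "Modules.additive (\<lambda>x :: complex^('n \<times> 'n)^('n \<times> 'n). x)"
    by unfold_locales simp
  show "modular2 0 (kron a b) = kron a b" for a b
    by (simp only: modular2_kron) (simp only: modular_0)
qed (rule modular2_additive)

lemma swap_modular2: "swap (modular2 z x) = modular2 z (swap x)"
proof (rule additive_eq_on_kron[where x = x])
  show "Modules.additive (\<lambda>x. swap (modular2 z x))"
    by unfold_locales (simp add: modular2_add swap_add)
  show "Modules.additive (\<lambda>x. modular2 z (swap x))"
    by unfold_locales (simp add: modular2_add swap_add)
qed (simp add: modular2_kron swap_kron)

text \<open>Since \<open>\<i> * \<i> = - 1\<close>, the complex powers become \<open>Q\<close> and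
  its inverse.\<close>

lemma modular2_\<i>: "modular2 \<i> x = kron (matrix_inv Q) (matrix_inv Q) ** x ** kron Q Q"
  by (simp add: tensor_map_modular cpow_1 cpow_uminus_1)

text \<open>Invariance at the single parameter \<open>\<i>\<close> says that \<open>e\<close>
  commutes with \<open>kron Q Q\<close>, and this passes to all complex powers.\<close>

lemma modular2_invariant:
  assumes "modular2 \<i> e = e"
  shows "modular2 z e = e"
proof -
  have "kron Q Q ** (kron (matrix_inv Q) (matrix_inv Q) ** e ** kron Q Q) = e ** kron Q Q"
    by (simp add: matrix_mul_assoc kron_mult Q_inverse kron_one)
  then have "e ** kron Q Q = kron Q Q ** e"
    using assms by (simp add: modular2_\<i>)
  then have "e ** kron (mat_cpow Q w) (mat_cpow Q w) = kron (mat_cpow Q w) (mat_cpow Q w) ** e" for w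
    by (rule kron_cpow_commute)
  then have "modular2 z e = e ** kron (mat_cpow Q (\<i> * z)) (mat_cpow Q (\<i> * z)) **
      kron (mat_cpow Q (- \<i> * z)) (mat_cpow Q (- \<i> * z))"
    by (simp add: tensor_map_modular)
  also have "\<dots> = e"
    by (simp add: kron_mult cpow_add cpow_0 kron_one flip: matrix_mul_assoc)
  finally show ?thesis .
qed

text \<open>This is \<open>op_act (kron Q (matrix_inv Q))\<close>; on matrices it is conjugation by
  \<open>Q\<close>.\<close>

definition weight_op :: "complex^('n \<times> 'n)^('n \<times> 'n)" where
  "weight_op = kron Q (transpose (matrix_inv Q))"

lemma cadj_inverse: "cadj (matrix_inv Q) = matrix_inv Q"
  using cadj_cpow[of "- 1"] by (simp add: cpow_uminus_1)

lemma cadj_weight_op: "cadj weight_op = weight_op"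
proof -
  have "cadj (transpose x) = transpose (cadj x)" for x :: "complex^'n^'n"
    by (simp add: cadj_def transpose_def)
  then show ?thesis by (simp add: weight_op_def cadj_kron cadj_Q cadj_inverse)
qed

lemma weight_op_inverse: "weight_op ** kron (matrix_inv Q) (transpose Q) = mat 1"
  "kron (matrix_inv Q) (transpose Q) ** weight_op = mat 1"
  by (simp_all add: weight_op_def kron_mult Q_inverse kron_one flip: matrix_transpose_mul)

lemma op_of_vec_weight_op: "op_of_vec (weight_op *v v) = Q ** op_of_vec v ** matrix_inv Q"
  by (simp add: weight_op_def op_of_vec_kron)

text \<open>Pulled back along \<open>op_act\<close>, the left side says that \<open>e\<close>
  commutes with \<open>kron Q (matrix_inv Q)\<close> for \<open>op_mult\<close>. The reversed
  product in the second leg puts \<open>matrix_inv Q\<close> on the opposite side, and cancelling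
  invertible one-leg factors leaves conjugation by \<open>kron Q Q\<close>.\<close>

lemma weight_op_commute_iff:
  "weight_op ** op_act e = op_act e ** weight_op \<longleftrightarrow> modular2 \<i> e = e"
proof -
  have "weight_op ** op_act e = op_act e ** weight_op \<longleftrightarrow>
      op_act (op_mult (kron Q (matrix_inv Q)) e) = op_act (op_mult e (kron Q (matrix_inv Q)))"
    by (simp add: op_act_op_mult op_act_kron weight_op_def)
  also have "\<dots> \<longleftrightarrow> op_mult (kron Q (matrix_inv Q)) e = op_mult e (kron Q (matrix_inv Q))"
    by (metis op_act_op_act)
  also have "\<dots> \<longleftrightarrow> kron Q (mat 1) ** e ** kron (mat 1) (matrix_inv Q)
      = kron (mat 1) (matrix_inv Q) ** e ** kron Q (mat 1)"
    by (simp add: op_mult_kron_left op_mult_kron_right)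
  also have "\<dots> \<longleftrightarrow> modular2 \<i> e = e"
  proof
    assume eq: "kron Q (mat 1) ** e ** kron (mat 1) (matrix_inv Q)
      = kron (mat 1) (matrix_inv Q) ** e ** kron Q (mat 1)"
    \<comment> \<open>The outer factors reduce the left side of \<open>eq\<close> to
      \<open>e\<close>, and its right side to \<open>modular2 \<i> e\<close>.\<close>
    have "e = kron (matrix_inv Q) (mat 1) ** (kron Q (mat 1) ** e ** kron (mat 1) (matrix_inv Q)) ** kron (mat 1) Q"
      by (simp add: matrix_mul_assoc kron_mult Q_inverse kron_one)
        (simp add: kron_mult Q_inverse kron_one flip: matrix_mul_assoc)
    also have "\<dots> = modular2 \<i> e"
      unfolding eq modular2_\<i> by (simp add: matrix_mul_assoc kron_mult)
        (simp add: kron_mult flip: matrix_mul_assoc)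
    finally show "modular2 \<i> e = e" ..
  next
    assume eq: "modular2 \<i> e = e"
    have "kron Q (mat 1) ** e ** kron (mat 1) (matrix_inv Q)
        = kron Q (mat 1) ** (kron (matrix_inv Q) (matrix_inv Q) ** e ** kron Q Q) ** kron (mat 1) (matrix_inv Q)"
      using eq by (simp add: modular2_\<i>)
    also have "\<dots> = kron (mat 1) (matrix_inv Q) ** e ** kron Q (mat 1)"
      by (simp add: matrix_mul_assoc kron_mult Q_inverse)
        (simp add: kron_mult Q_inverse flip: matrix_mul_assoc)
    finally show "kron Q (mat 1) ** e ** kron (mat 1) (matrix_inv Q)
      = kron (mat 1) (matrix_inv Q) ** e ** kron Q (mat 1)" .
  qed
  finally show ?thesis .
qed

text \<open>A hermitian operator preserving \<open>V\<close> commutes with the projection onto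
  \<open>V\<close>, and then so does its inverse; hence the inverse preserves \<open>V\<close>
  too.\<close>

lemma weight_op_image_eq:
  assumes V: "vec.subspace V" and sub: "(\<lambda>v. weight_op *v v) ` V \<subseteq> V"
  shows "(\<lambda>v. weight_op *v v) ` V = V"
proof -
  let ?R' = "kron (matrix_inv Q) (transpose Q)"
  obtain P where P: "cadj P = P" "P ** P = P" and range: "range (\<lambda>v. P *v v) = V"
    using orthogonal_projection_exists[OF V] by blast
  have "weight_op ** P = P ** weight_op"
    by (rule projection_commute[OF P]) (simp_all add: range cadj_weight_op sub)
  then have comm: "?R' ** (weight_op ** P) ** ?R' = ?R' ** (P ** weight_op) ** ?R'" by simp
  have "?R' ** P = P ** ?R'"
  proof -
    have "?R' ** (weight_op ** P) ** ?R' = P ** ?R'"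
      by (simp add: matrix_mul_assoc weight_op_inverse)
    moreover have "?R' ** (P ** weight_op) ** ?R' = ?R' ** P"
      by (simp add: weight_op_inverse flip: matrix_mul_assoc)
    ultimately show ?thesis using comm by simp
  qed
  then have inv: "(\<lambda>v. ?R' *v v) ` V \<subseteq> V"
    using range_commute range by metis
  have "V \<subseteq> (\<lambda>v. weight_op *v v) ` V"
  proof
    fix v assume "v \<in> V"
    then have "?R' *v v \<in> V" using inv by blast
    moreover have "v = weight_op *v (?R' *v v)"
      by (simp add: matrix_vector_mul_assoc weight_op_inverse)
    ultimately show "v \<in> (\<lambda>v. weight_op *v v) ` V" by blast
  qed
  with sub show ?thesis by blast
qed

lemma conjugation_image: "(\<lambda>s. Q ** s ** matrix_inv Q) ` op_of_vec ` V = op_of_vec ` (\<lambda>v. weight_op *v v) ` V"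
  by (simp add: image_image op_of_vec_weight_op)

text \<open>All conditions are transported along the bijection \<open>op_of_vec\<close>, whose
  inverse is \<open>vec_of_op\<close>.\<close>

lemma bij_subspaces_bimodules:
  assumes B: "unital_star_subalgebra B"
  shows "bij_betw (\<lambda>V. op_of_vec ` V)
    {V \<in> symmetric_invariant_subspaces B. (\<lambda>v. weight_op *v v) ` V \<subseteq> V}
    {S \<in> selfadjoint_bimodules B. (\<lambda>s. Q ** s ** matrix_inv Q) ` S \<subseteq> S}"
proof (rule bij_betwI')
  fix V W :: "(complex^('n \<times> 'n)) set"
  show "(op_of_vec ` V = op_of_vec ` W) = (V = W)"
    by (rule op_of_vec_image_eq_iff)
  assume "V \<in> {V \<in> symmetric_invariant_subspaces B. (\<lambda>v. weight_op *v v) ` V \<subseteq> V}"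
  then show "op_of_vec ` V \<in> {S \<in> selfadjoint_bimodules B. (\<lambda>s. Q ** s ** matrix_inv Q) ` S \<subseteq> S}"
    using bimodule_iff_symmetric_invariant[OF B]
    by (simp add: conjugation_image op_of_vec_image_subset_iff)
next
  fix S assume S: "S \<in> {S \<in> selfadjoint_bimodules B. (\<lambda>s. Q ** s ** matrix_inv Q) ` S \<subseteq> S}"
  define V where "V = vec_of_op ` S"
  have eq: "S = op_of_vec ` V" by (simp add: V_def image_image)
  have "V \<in> {V \<in> symmetric_invariant_subspaces B. (\<lambda>v. weight_op *v v) ` V \<subseteq> V}"
    using S bimodule_iff_symmetric_invariant[OF B]
    unfolding eq by (simp add: conjugation_image op_of_vec_image_subset_iff)
  then show "\<exists>V\<in>{V \<in> symmetric_invariant_subspaces B. (\<lambda>v. weight_op *v v) ` V \<subseteq> V}. S = op_of_vec ` V"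
    using eq by blast
qed

lemma conjugation_image_eq:
  assumes B: "unital_star_subalgebra B" and S: "S \<in> selfadjoint_bimodules B"
    and sub: "(\<lambda>s. Q ** s ** matrix_inv Q) ` S \<subseteq> S"
  shows "(\<lambda>s. Q ** s ** matrix_inv Q) ` S = S"
proof -
  define V where "V = vec_of_op ` S"
  have eq: "S = op_of_vec ` V" by (simp add: V_def image_image)
  have "vec.subspace V"
    using S by (simp add: eq selfadjoint_bimodules_def op_of_vec_subspace_iff)
  moreover have "(\<lambda>v. weight_op *v v) ` V \<subseteq> V"
    using sub by (simp add: eq conjugation_image op_of_vec_image_subset_iff)
  ultimately show ?thesis
    by (simp add: eq conjugation_image weight_op_image_eq)
qed

text \<open>An orthogonal projection is determined by its range, which gives injectivity. For
  surjectivity, the projection onto \<open>V\<close> is pulled back along \<open>op_act\<close>, and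
  each condition on \<open>V\<close> is turned into one on the projection by
  \<open>projection_commute\<close> or by uniqueness.\<close>

lemma bij_projections_subspaces:
  assumes B: "unital_star_subalgebra B"
  shows "bij_betw (\<lambda>e. range (\<lambda>v. op_act e *v v)) (invariant_projections B Q)
    {V \<in> symmetric_invariant_subspaces B. (\<lambda>v. weight_op *v v) ` V \<subseteq> V}"
proof (rule bij_betwI')
  have proj: "cadj (op_act e) = op_act e" "op_act e ** op_act e = op_act e"
    if "e \<in> invariant_projections B Q" for e
    using that by (simp_all add: invariant_projections_def cadj_op_act flip: op_act_op_mult)
  fix e e' assume "e \<in> invariant_projections B Q" "e' \<in> invariant_projections B Q"
  then show "(range (\<lambda>v. op_act e *v v) = range (\<lambda>v. op_act e' *v v)) = (e = e')"
    by (metis op_act_op_act orthogonal_projection_unique proj)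
next
  fix e assume e: "e \<in> invariant_projections B Q"
  then have eB: "e \<in> tensor_alg B" and adj: "cadj e = e" and sw: "swap e = e" and mod: "modular2 \<i> e = e"
    by (auto simp: invariant_projections_def)
  let ?V = "range (\<lambda>v. op_act e *v v)"
  have "op_act x *v v \<in> ?V" if "x \<in> tensor_alg (commutant B)" "v \<in> ?V" for x v
    using range_commute[OF op_act_commute[OF B that(1) eB]] that(2) by blast
  moreover have "J0 ` ?V = ?V"
  proof -
    have "J0 ` ?V \<subseteq> ?V" by (auto simp: J0_op_act adj sw)
    moreover from this have "?V \<subseteq> J0 ` ?V" by (metis (no_types, lifting) J0_J0 image_subset_iff imageI subsetI)
    ultimately show ?thesis by blast
  qed
  moreover have "(\<lambda>v. weight_op *v v) ` ?V \<subseteq> ?V"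
    by (rule range_commute) (simp add: weight_op_commute_iff mod)
  ultimately show "?V \<in> {V \<in> symmetric_invariant_subspaces B. (\<lambda>v. weight_op *v v) ` V \<subseteq> V}"
    unfolding symmetric_invariant_subspaces_def using subspace_range by blast
next
  fix V assume "V \<in> {V \<in> symmetric_invariant_subspaces B. (\<lambda>v. weight_op *v v) ` V \<subseteq> V}"
  then have V: "vec.subspace V" and inv: "\<And>x v. x \<in> tensor_alg (commutant B) \<Longrightarrow> v \<in> V \<Longrightarrow> op_act x *v v \<in> V"
    and J: "J0 ` V = V" and W: "(\<lambda>v. weight_op *v v) ` V \<subseteq> V"
    by (auto simp: symmetric_invariant_subspaces_def)
  obtain P where P: "cadj P = P" "P ** P = P" and range: "range (\<lambda>v. P *v v) = V"
    using orthogonal_projection_exists[OF V] by blast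
  \<comment> \<open>\<open>op_act\<close> is an involution, so this \<open>e\<close> acts as
    \<open>P\<close>.\<close>
  define e where "e = op_act P"
  have Pe: "P = op_act e" by (simp add: e_def)
  have adj: "cadj e = e" by (simp add: e_def P cadj_op_act)
  have idem: "op_mult e e = e" by (metis P(2) Pe op_act_op_act op_act_op_mult)
  note B' = unital_star_subalgebraD[OF commutant_unital_star_subalgebra[OF B]]
  have "e \<in> tensor_alg B"
  proof (rule commutant_tensor_alg[OF B])
    fix x y assume xy: "x \<in> commutant B" "y \<in> commutant B"
    have "op_act (kron x y) ** P = P ** op_act (kron x y)"
      by (rule projection_commute[OF P])
        (auto simp: range cadj_op_act cadj_kron intro!: inv kron_in_tensor_alg xy B')
    then show "op_act (kron x y) ** op_act e = op_act e ** op_act (kron x y)" by (simp add: Pe)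
  qed
  moreover have "e = swap e"
  proof -
    \<comment> \<open>\<open>?P'\<close> is \<open>P\<close> conjugated by \<open>J0\<close>, hence
      the orthogonal projection onto the image of \<open>V\<close> under \<open>J0\<close>. That
      image is \<open>V\<close>, so uniqueness applies.\<close>
    let ?P' = "op_act (swap e)"
    have J0P: "J0 (P *v v) = ?P' *v J0 v" for v
      by (simp add: Pe J0_op_act adj)
    have "?P' ** ?P' = ?P'"
    proof -
      have "?P' *v (?P' *v v) = ?P' *v v" for v
      proof -
        have "?P' *v (?P' *v v) = J0 (P *v (P *v J0 v))" by (simp only: J0P J0_J0)
        also have "\<dots> = ?P' *v v" by (simp only: matrix_vector_mul_assoc P J0P J0_J0)
        finally show ?thesis .
      qed
      then show ?thesis by (simp add: matrix_eq flip: matrix_vector_mul_assoc)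
    qed
    moreover have "cadj ?P' = ?P'" by (simp add: cadj_op_act cadj_swap adj)
    moreover have "range (\<lambda>v. ?P' *v v) = range (\<lambda>v. P *v v)"
    proof -
      have "range (\<lambda>v. ?P' *v v) = range (\<lambda>v. ?P' *v J0 v)"
        by (metis (no_types, lifting) J0_J0 image_cong image_image surjI)
      also have "\<dots> = J0 ` range (\<lambda>v. P *v v)" by (simp add: image_image J0P)
      finally show ?thesis by (simp add: range J)
    qed
    ultimately have "?P' = P" using orthogonal_projection_unique P by metis
    then show ?thesis by (simp add: e_def) (metis op_act_op_act)
  qed
  moreover have "modular2 \<i> e = e"
  proof -
    have "weight_op ** P = P ** weight_op"
      by (rule projection_commute[OF P]) (simp_all add: range cadj_weight_op W)
    then show ?thesis by (simp add: Pe weight_op_commute_iff)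
  qed
  ultimately have "e \<in> invariant_projections B Q"
    using adj idem by (simp add: invariant_projections_def modular2_invariant)
  then show "\<exists>e\<in>invariant_projections B Q. V = range (\<lambda>v. op_act e *v v)"
    using range Pe by blast
qed

end

section \<open>Adjacency operators\<close>

lemma matrix_mult_nth: "(A ** B) $ i $ j = (\<Sum>k\<in>UNIV. A $ i $ k * B $ k $ j)"
  by (simp add: matrix_matrix_mult_def)

lemma basis_map_mult_right: "(X ** basis_map f) $ i $ j = X $ i $ f j"
  by (simp add: basis_map_def matrix_matrix_mult_def if_distrib[of "\<lambda>x. _ * x"] cong: if_cong)

lemma sum_delta_mult [simp]:
  fixes f :: "'a::finite \<Rightarrow> 'b::semiring_1"
  shows "(\<Sum>k\<in>UNIV. (if i = k then 1 else 0) * f k) = f i" "(\<Sum>k\<in>UNIV. f k * (if k = i then 1 else 0)) = f i"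
  by (simp_all add: if_distrib[of "\<lambda>x. _ * x"] if_distrib[of "\<lambda>x. x * _"] cong: if_cong)

text \<open>Contracts the tensor network of \<open>transpose_r\<close> once and for all:
  \<open>Z\<close> stands for \<open>\<eta>\<^sup>* m (A \<otimes> 1)\<close> and \<open>u\<close>
  for \<open>m\<^sup>* \<eta>\<close>, while the \<open>basis_map\<close> factors are the unit and
  associativity isomorphisms.\<close>

lemma transpose_r_aux:
  fixes Z :: "complex^('l::finite \<times> 'l)^1" and u :: "complex^1^('l \<times> 'l)"
  shows "((basis_map fst :: complex^('l \<times> 1)^'l) ** kron (mat 1) Z
    ** (basis_map (\<lambda>((i, j), k). (i, (j, k))) :: complex^(('l \<times> 'l) \<times> 'l)^('l \<times> ('l \<times> 'l)))
    ** kron u (mat 1) ** (basis_map (Pair 1) :: complex^'l^(1 \<times> 'l))) $ i $ s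
    = (\<Sum>b\<in>UNIV. Z $ 1 $ (b, s) * u $ (i, b) $ 1)"
proof -
  have 1: "((basis_map fst :: complex^('l \<times> 1)^'l) ** kron (mat 1) Z) $ i $ (a, b, c) =
      (if i = a then Z $ 1 $ (b, c) else 0)" for a b c
  proof -
    have "((basis_map fst :: complex^('l \<times> 1)^'l) ** kron (mat 1) Z) $ i $ (a, b, c) =
        (\<Sum>k\<in>UNIV. if k = i then (if k = a then 1 else 0) * Z $ 1 $ (b, c) else 0)"
      by (auto simp: matrix_matrix_mult_def basis_map_def kron_def mat_def sum_UNIV_prod sum_1 intro!: sum.cong simp del: sum.delta sum.delta' sum_delta_mult)
    then show ?thesis by simp
  qed
  have "(\<Sum>a\<in>UNIV. \<Sum>b\<in>UNIV. \<Sum>c\<in>UNIV. (if i = a then Z $ 1 $ (b, c) else 0) * (u $ (a, b) $ 1 * (if c = s then 1 else 0)))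
      = (\<Sum>a\<in>UNIV. if i = a then \<Sum>b\<in>UNIV. \<Sum>c\<in>UNIV. Z $ 1 $ (b, c) * u $ (a, b) $ 1 * (if c = s then 1 else 0) else 0)"
    by (intro sum.cong refl) (simp add: mult.assoc)
  also have "\<dots> = (\<Sum>b\<in>UNIV. Z $ 1 $ (b, s) * u $ (i, b) $ 1)"
    by simp
  finally have 2: "(\<Sum>a\<in>UNIV. \<Sum>b\<in>UNIV. \<Sum>c\<in>UNIV. (if i = a then Z $ 1 $ (b, c) else 0) * (u $ (a, b) $ 1 * (if c = s then 1 else 0)))
      = (\<Sum>b\<in>UNIV. Z $ 1 $ (b, s) * u $ (i, b) $ 1)" .
  have 3: "kron u (mat 1 :: complex^'l^'l) $ ((a, b), c) $ (1, s) = u $ (a, b) $ 1 * (if c = s then 1 else 0)" for a b c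
    by (simp add: kron_def mat_def)
  show ?thesis
    unfolding basis_map_mult_right
    by (subst matrix_mult_nth) (simp only: sum_UNIV_prod basis_map_mult_right prod.case 1 3 2)
qed

text \<open>Mirror image of \<open>transpose_r_aux\<close>, with \<open>Z\<close> standing for
  \<open>\<eta>\<^sup>* m (1 \<otimes> A)\<close>.\<close>

lemma transpose_l_aux:
  fixes Z :: "complex^('l::finite \<times> 'l)^1" and u :: "complex^1^('l \<times> 'l)"
  shows "((basis_map snd :: complex^(1 \<times> 'l)^'l) ** kron Z (mat 1)
    ** (basis_map (\<lambda>(i, (j, k)). ((i, j), k)) :: complex^('l \<times> ('l \<times> 'l))^(('l \<times> 'l) \<times> 'l))
    ** kron (mat 1) u ** (basis_map (\<lambda>i. (i, 1)) :: complex^'l^('l \<times> 1))) $ i $ s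
    = (\<Sum>b\<in>UNIV. Z $ 1 $ (s, b) * u $ (b, i) $ 1)"
proof -
  have 1: "((basis_map snd :: complex^(1 \<times> 'l)^'l) ** kron Z (mat 1)) $ i $ ((a, b), c) =
      (if i = c then Z $ 1 $ (a, b) else 0)" for a b c
  proof -
    have "((basis_map snd :: complex^(1 \<times> 'l)^'l) ** kron Z (mat 1)) $ i $ ((a, b), c) =
        (\<Sum>k\<in>UNIV. if k = i then (if k = c then 1 else 0) * Z $ 1 $ (a, b) else 0)"
      by (auto simp: matrix_matrix_mult_def basis_map_def kron_def mat_def sum_UNIV_prod sum_1 intro!: sum.cong simp del: sum.delta sum.delta' sum_delta_mult)
    then show ?thesis by simp
  qed
  have "(\<Sum>a\<in>UNIV. \<Sum>b\<in>UNIV. \<Sum>c\<in>UNIV. (if i = c then Z $ 1 $ (a, b) else 0) * ((if a = s then 1 else 0) * u $ (b, c) $ 1))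
      = (\<Sum>a\<in>UNIV. (\<Sum>b\<in>UNIV. \<Sum>c\<in>UNIV. if i = c then Z $ 1 $ (a, b) * u $ (b, c) $ 1 else 0) * (if a = s then 1 else 0))"
    by (intro sum.cong refl) (auto simp del: sum.delta sum.delta' sum_delta_mult intro!: sum.cong)
  also have "\<dots> = (\<Sum>b\<in>UNIV. Z $ 1 $ (s, b) * u $ (b, i) $ 1)"
    by simp
  finally have 2: "(\<Sum>a\<in>UNIV. \<Sum>b\<in>UNIV. \<Sum>c\<in>UNIV. (if i = c then Z $ 1 $ (a, b) else 0) * ((if a = s then 1 else 0) * u $ (b, c) $ 1))
      = (\<Sum>b\<in>UNIV. Z $ 1 $ (s, b) * u $ (b, i) $ 1)" .
  have 3: "kron (mat 1 :: complex^'l^'l) u $ (a, (b, c)) $ (s, 1) = (if a = s then 1 else 0) * u $ (b, c) $ 1" for a b c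
    by (simp add: kron_def mat_def)
  show ?thesis
    unfolding basis_map_mult_right
    by (subst matrix_mult_nth) (simp only: sum_UNIV_prod basis_map_mult_right prod.case 1 3 2)
qed

lemma mult_theta: "X ** theta v w = theta v (X *v w)"
  by (simp add: theta_def matrix_matrix_mult_def matrix_vector_mult_def vec_eq_iff sum_distrib_right sum_distrib_left mult_ac)

lemma theta_mult_cadj: "theta v w ** cadj Y = theta (Y *v v) w"
  by (metis cadj_cadj cadj_mult cadj_theta mult_theta)

lemma kron_theta: "kron (theta v w) (theta v' w') = theta (tensor_vec v v') (tensor_vec w w')"
  by (simp add: kron_def theta_def tensor_vec_def vec_eq_iff)

lemma theta_extend_additive: "Modules.additive (theta_extend B \<Lambda> f)"
  using theta_extend_linear[of B \<Lambda> f] by (simp add: clinear_on_def Modules.additive_def)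

text \<open>\<open>\<tau>\<close> stands for the trace transported from the block-diagonal model; it
  enters through the trace property and the density formula for \<open>\<psi>\<close>.\<close>

locale weighted_gns = positive_invertible Q for Q :: "complex^'n^'n" +
  fixes B :: "(complex^'n^'n) set" and \<tau> \<psi> :: "complex^'n^'n \<Rightarrow> complex" and \<Lambda> :: "complex^'n^'n \<Rightarrow> complex^'l"
  assumes B: "unital_star_subalgebra B" and Q_in_B: "Q \<in> B"
    and trace: "\<And>a b. a \<in> B \<Longrightarrow> b \<in> B \<Longrightarrow> \<tau> (a ** b) = \<tau> (b ** a)"
    and \<psi>_eq: "\<And>a. a \<in> B \<Longrightarrow> \<psi> a = \<tau> (Q ** a)"
    and gns: "gns_map B \<psi> \<Lambda>"
begin

lemmas B_closed [simp] = unital_star_subalgebraD[OF B]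

lemma \<Lambda>_inner: "a \<in> B \<Longrightarrow> b \<in> B \<Longrightarrow> cinner (\<Lambda> a) (\<Lambda> b) = \<psi> (cadj a ** b)"
  and \<Lambda>_bij: "bij_betw \<Lambda> B UNIV" and \<Lambda>_linear: "clinear_on B cscale (*s) \<Lambda>"
  using gns by (auto simp: gns_map_def)

lemma \<Lambda>_surj: obtains a where "a \<in> B" "v = \<Lambda> a"
  using \<Lambda>_bij by (metis UNIV_I bij_betw_def imageE)

lemma \<Lambda>_gns_inv [simp]: "\<Lambda> (gns_inv B \<Lambda> v) = v"
  using \<Lambda>_bij by (simp add: bij_betw_def f_inv_into_f)

lemma gns_inv_in_B [simp]: "gns_inv B \<Lambda> v \<in> B"
  by (rule gns_inv_in[OF \<Lambda>_bij])

text \<open>Powers of \<open>Q\<close> commute with everything that commutes with \<open>Q\<close>,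
  so they lie in the bicommutant of \<open>B\<close>.\<close>

lemma cpow_in_B [simp]: "mat_cpow Q w \<in> B"
proof -
  have "mat_cpow Q w \<in> commutant (commutant B)"
    using Q_in_B by (auto simp: commutant_def intro!: cpow_commute[symmetric])
  then show ?thesis by (simp add: bicommutant[OF B])
qed

lemma modular_in_B [simp]: "a \<in> B \<Longrightarrow> modular Q z a \<in> B"
  by (simp add: modular_def)

text \<open>The KMS property of \<open>\<psi>\<close>: \<open>modular Q (- \<i>) a\<close> is
  \<open>Q ** a ** matrix_inv Q\<close>, and the trace property cycles the factors.\<close>

lemma \<psi>_mult_commute:
  assumes a: "a \<in> B" and b: "b \<in> B"
  shows "\<psi> (a ** b) = \<psi> (b ** modular Q (- \<i>) a)"
proof -
  have Qi: "matrix_inv Q \<in> B" using cpow_in_B[of "- 1"] by (simp add: cpow_uminus_1)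
  have "\<psi> (b ** modular Q (- \<i>) a) = \<tau> (Q ** (b ** (Q ** a ** matrix_inv Q)))"
    using a b by (simp add: \<psi>_eq) (simp add: modular_def cpow_1 cpow_uminus_1)
  also have "\<dots> = \<tau> ((b ** (Q ** a ** matrix_inv Q)) ** Q)"
    using a b Q_in_B Qi by (intro trace) simp_all
  also have "(b ** (Q ** a ** matrix_inv Q)) ** Q = b ** (Q ** a)"
    by (simp add: Q_inverse flip: matrix_mul_assoc)
  also have "\<tau> (b ** (Q ** a)) = \<tau> ((Q ** a) ** b)"
    using a b Q_in_B by (intro trace) simp_all
  also have "\<dots> = \<psi> (a ** b)" using a b by (simp add: \<psi>_eq matrix_mul_assoc)
  finally show ?thesis ..
qed

lemma \<psi>_conv_cinner: "a \<in> B \<Longrightarrow> b \<in> B \<Longrightarrow> \<psi> (a ** b) = cinner (\<Lambda> (cadj a)) (\<Lambda> b)"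
  by (simp add: \<Lambda>_inner)

text \<open>The pairing \<open>\<eta>\<^sup>* m\<close> as a row, so that its adjoint
  \<open>m\<^sup>* \<eta>\<close> is a column; both transposes are contractions against these
  two.\<close>

definition counit_mult :: "complex^('l \<times> 'l)^1" where
  "counit_mult = cadj (gns_unit \<Lambda>) ** gns_mult B \<Lambda>"

lemma counit_mult_tensor:
  assumes "a \<in> B" "b \<in> B"
  shows "(\<Sum>p\<in>UNIV. \<Sum>q\<in>UNIV. counit_mult $ 1 $ (p, q) * (\<Lambda> a $ p * \<Lambda> b $ q)) = \<psi> (a ** b)"
proof -
  have "(\<Sum>p\<in>UNIV. \<Sum>q\<in>UNIV. counit_mult $ 1 $ (p, q) * (\<Lambda> a $ p * \<Lambda> b $ q))
      = (counit_mult *v tensor_vec (\<Lambda> a) (\<Lambda> b)) $ 1"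
    by (simp add: matrix_vector_mult_def tensor_vec_def sum_UNIV_prod)
  also have "\<dots> = (cadj (gns_unit \<Lambda>) *v \<Lambda> (a ** b)) $ 1"
    by (simp add: counit_mult_def gns_mult_tensor[OF B gns] assms flip: matrix_vector_mul_assoc)
  also have "\<dots> = cinner (\<Lambda> (mat 1)) (\<Lambda> (a ** b))"
    by (simp add: cinner_def matrix_vector_mult_def cadj_def gns_unit_def)
  also have "\<dots> = \<psi> (a ** b)" using assms by (simp add: \<Lambda>_inner)
  finally show ?thesis .
qed

abbreviation basis_element :: "'l \<Rightarrow> complex^'n^'n" where
  "basis_element p \<equiv> gns_inv B \<Lambda> (axis p 1)"

text \<open>\<open>\<Lambda>\<close> of a basis element is a coordinate vector, which collapses one
  of the two sums in \<open>counit_mult_tensor\<close>.\<close>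

lemma counit_mult_left:
  assumes "a \<in> B"
  shows "(\<Sum>p\<in>UNIV. counit_mult $ 1 $ (p, s) * \<Lambda> a $ p) = \<psi> (a ** basis_element s)"
  using counit_mult_tensor[OF assms, of "basis_element s"]
  by (simp add: axis_def if_distrib[of "\<lambda>x. _ * x"] cong: if_cong)

lemma counit_mult_right:
  assumes "a \<in> B"
  shows "(\<Sum>p\<in>UNIV. counit_mult $ 1 $ (s, p) * \<Lambda> a $ p) = \<psi> (basis_element s ** a)"
proof -
  have "(\<Sum>p\<in>UNIV. counit_mult $ 1 $ (s, p) * \<Lambda> a $ p) =
      (\<Sum>p\<in>UNIV. if p = s then \<Sum>q\<in>UNIV. counit_mult $ 1 $ (p, q) * \<Lambda> a $ q else 0)"
    by simp
  also have "\<dots> = (\<Sum>p\<in>UNIV. \<Sum>q\<in>UNIV. counit_mult $ 1 $ (p, q) * (\<Lambda> (basis_element s) $ p * \<Lambda> a $ q))"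
    by (auto simp: axis_def intro!: sum.cong simp del: sum.delta sum.delta' sum_delta_mult)
  also have "\<dots> = \<psi> (basis_element s ** a)"
    by (rule counit_mult_tensor) (simp_all add: assms)
  finally show ?thesis .
qed

lemma cadj_counit_mult: "cadj (gns_mult B \<Lambda>) ** gns_unit \<Lambda> = cadj counit_mult"
  by (simp add: counit_mult_def cadj_mult)

text \<open>Merging the two adjacent \<open>kron\<close> factors around \<open>A\<close> brings the
  definition into the form of \<open>transpose_r_aux\<close>.\<close>

lemma transpose_r_nth:
  "transpose_r B \<Lambda> A $ i $ s =
    (\<Sum>b\<in>UNIV. (\<Sum>p\<in>UNIV. counit_mult $ 1 $ (p, s) * A $ p $ b) * cnj (counit_mult $ 1 $ (i, b)))"
proof -
  have "transpose_r B \<Lambda> A = (basis_map fst :: complex^('l \<times> 1)^'l)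
    ** kron (mat 1) (counit_mult ** kron A (mat 1))
    ** (basis_map (\<lambda>((i, j), k). (i, (j, k))) :: complex^(('l \<times> 'l) \<times> 'l)^('l \<times> ('l \<times> 'l)))
    ** kron (cadj counit_mult) (mat 1) ** (basis_map (Pair 1) :: complex^'l^(1 \<times> 'l))"
    unfolding transpose_r_def cadj_counit_mult counit_mult_def[symmetric]
      matrix_mul_assoc[of "basis_map fst :: complex^('l \<times> 1)^'l", symmetric] kron_mult
    by (simp only: matrix_mul_assoc matrix_mul_lid)
  moreover have "(counit_mult ** kron A (mat 1)) $ 1 $ (b, s) = (\<Sum>p\<in>UNIV. counit_mult $ 1 $ (p, s) * A $ p $ b)" for b
    by (simp add: matrix_matrix_mult_def kron_def mat_def sum_UNIV_prod flip: mult.assoc)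
  moreover have "cadj counit_mult $ (i, b) $ 1 = cnj (counit_mult $ 1 $ (i, b))" for b
    by (simp add: cadj_def)
  ultimately show ?thesis by (simp only: transpose_r_aux)
qed

lemma transpose_l_nth:
  "transpose_l B \<Lambda> A $ i $ s =
    (\<Sum>b\<in>UNIV. (\<Sum>p\<in>UNIV. counit_mult $ 1 $ (s, p) * A $ p $ b) * cnj (counit_mult $ 1 $ (b, i)))"
proof -
  have "transpose_l B \<Lambda> A = (basis_map snd :: complex^(1 \<times> 'l)^'l)
    ** kron (counit_mult ** kron (mat 1) A) (mat 1)
    ** (basis_map (\<lambda>(i, (j, k)). ((i, j), k)) :: complex^('l \<times> ('l \<times> 'l))^(('l \<times> 'l) \<times> 'l))
    ** kron (mat 1) (cadj counit_mult) ** (basis_map (\<lambda>i. (i, 1)) :: complex^'l^('l \<times> 1))"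
    unfolding transpose_l_def cadj_counit_mult counit_mult_def[symmetric]
      matrix_mul_assoc[of "basis_map snd :: complex^(1 \<times> 'l)^'l", symmetric] kron_mult
    by (simp only: matrix_mul_assoc matrix_mul_lid)
  moreover have "(counit_mult ** kron (mat 1) A) $ 1 $ (s, b) = (\<Sum>p\<in>UNIV. counit_mult $ 1 $ (s, p) * A $ p $ b)" for b
  proof -
    have "(counit_mult ** kron (mat 1) A) $ 1 $ (s, b) =
        (\<Sum>q\<in>UNIV. if q = s then \<Sum>p\<in>UNIV. counit_mult $ 1 $ (q, p) * A $ p $ b else 0)"
      by (auto simp: matrix_matrix_mult_def kron_def mat_def sum_UNIV_prod intro!: sum.cong
          simp del: sum.delta sum.delta' sum_delta_mult)
    then show ?thesis by simp
  qed
  moreover have "cadj counit_mult $ (b, i) $ 1 = cnj (counit_mult $ 1 $ (b, i))" for b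
    by (simp add: cadj_def)
  ultimately show ?thesis by (simp only: transpose_l_aux)
qed

section \<open>Transposes of rank-one operators\<close>

lemma \<Lambda>_nth: "a \<in> B \<Longrightarrow> \<Lambda> a $ i = cinner (\<Lambda> (basis_element i)) (\<Lambda> a)"
  by simp

text \<open>For basis elements \<open>x\<close> and \<open>y\<close>, the contraction is
  \<open>\<psi> (b ** x)\<close> times the conjugate of \<open>\<psi> (y ** a)\<close>. The first
  factor is already an inner product; in the second, after conjugation, \<open>cadj a\<close> must
  be moved to the right, which costs \<open>modular Q (- \<i>)\<close>.\<close>

lemma transpose_r_theta:
  assumes a: "a \<in> B" and b: "b \<in> B"
  shows "transpose_r B \<Lambda> (theta (\<Lambda> a) (\<Lambda> b)) = theta (\<Lambda> (cadj b)) (\<Lambda> (modular Q (- \<i>) (cadj a)))"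
proof -
  have "transpose_r B \<Lambda> (theta (\<Lambda> a) (\<Lambda> b)) $ i $ s
      = theta (\<Lambda> (cadj b)) (\<Lambda> (modular Q (- \<i>) (cadj a))) $ i $ s" for i s
  proof -
    have "transpose_r B \<Lambda> (theta (\<Lambda> a) (\<Lambda> b)) $ i $ s =
        (\<Sum>p\<in>UNIV. counit_mult $ 1 $ (p, s) * \<Lambda> b $ p) * cnj (\<Sum>q\<in>UNIV. counit_mult $ 1 $ (i, q) * \<Lambda> a $ q)"
      by (simp add: transpose_r_nth theta_def sum_distrib_left sum_distrib_right mult_ac)
    also have "\<dots> = \<psi> (b ** basis_element s) * cnj (\<psi> (basis_element i ** a))"
      by (simp only: counit_mult_left[OF b] counit_mult_right[OF a])
    also have "\<psi> (b ** basis_element s) = cnj (\<Lambda> (cadj b) $ s)"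
      using b by (simp only: \<psi>_conv_cinner gns_inv_in_B \<Lambda>_nth B_closed cinner_commute)
    also have "cnj (\<psi> (basis_element i ** a)) = \<psi> (cadj a ** cadj (basis_element i))"
      using a by (simp only: \<psi>_conv_cinner gns_inv_in_B cinner_commute B_closed cadj_cadj)
    also have "\<dots> = \<psi> (cadj (basis_element i) ** modular Q (- \<i>) (cadj a))"
      using a by (simp only: \<psi>_mult_commute gns_inv_in_B B_closed)
    also have "\<dots> = \<Lambda> (modular Q (- \<i>) (cadj a)) $ i"
      using a by (simp only: \<psi>_conv_cinner gns_inv_in_B \<Lambda>_nth B_closed modular_in_B cadj_cadj)
    finally show ?thesis by (simp add: theta_def mult.commute)
  qed
  then show ?thesis by (simp add: vec_eq_iff)
qed

text \<open>Mirror image of \<open>transpose_r_theta\<close>: here \<open>b\<close> must be moved to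
  the left of a basis element, which costs \<open>modular Q \<i>\<close>.\<close>

lemma transpose_l_theta:
  assumes a: "a \<in> B" and b: "b \<in> B"
  shows "transpose_l B \<Lambda> (theta (\<Lambda> a) (\<Lambda> b)) = theta (\<Lambda> (cadj (modular Q \<i> b))) (\<Lambda> (cadj a))"
proof -
  have "transpose_l B \<Lambda> (theta (\<Lambda> a) (\<Lambda> b)) $ i $ s
      = theta (\<Lambda> (cadj (modular Q \<i> b))) (\<Lambda> (cadj a)) $ i $ s" for i s
  proof -
    have "transpose_l B \<Lambda> (theta (\<Lambda> a) (\<Lambda> b)) $ i $ s =
        (\<Sum>p\<in>UNIV. counit_mult $ 1 $ (s, p) * \<Lambda> b $ p) * cnj (\<Sum>q\<in>UNIV. counit_mult $ 1 $ (q, i) * \<Lambda> a $ q)"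
      by (simp add: transpose_l_nth theta_def sum_distrib_left sum_distrib_right mult_ac)
    also have "\<dots> = \<psi> (basis_element s ** b) * cnj (\<psi> (a ** basis_element i))"
      by (simp only: counit_mult_left[OF a] counit_mult_right[OF b])
    also have "\<psi> (basis_element s ** b) = \<psi> (modular Q \<i> b ** basis_element s)"
      using b \<psi>_mult_commute[of "modular Q \<i> b" "basis_element s"] by (simp add: modular_modular modular_0)
    also have "\<dots> = cnj (\<Lambda> (cadj (modular Q \<i> b)) $ s)"
      using b by (simp only: \<psi>_conv_cinner gns_inv_in_B \<Lambda>_nth B_closed modular_in_B cinner_commute)
    also have "cnj (\<psi> (a ** basis_element i)) = \<Lambda> (cadj a) $ i"
      using a by (simp only: \<psi>_conv_cinner gns_inv_in_B \<Lambda>_nth cinner_commute B_closed)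
    finally show ?thesis by (simp add: theta_def mult.commute)
  qed
  then show ?thesis by (simp add: vec_eq_iff)
qed

lemma transpose_r_additive: "Modules.additive (transpose_r B \<Lambda>)"
  by unfold_locales (simp add: vec_eq_iff transpose_r_nth algebra_simps sum.distrib)

lemma transpose_l_additive: "Modules.additive (transpose_l B \<Lambda>)"
  by unfold_locales (simp add: vec_eq_iff transpose_l_nth algebra_simps sum.distrib)

section \<open>What \<open>\<Psi>\<close> does to transposes, adjoints and Schur products\<close>

abbreviation \<Psi> :: "complex^'l^'l \<Rightarrow> complex^('n \<times> 'n)^('n \<times> 'n)" where
  "\<Psi> \<equiv> Psi B \<Lambda> Q"

lemma \<Psi>_theta: "a \<in> B \<Longrightarrow> b \<in> B \<Longrightarrow> \<Psi> (theta (\<Lambda> a) (\<Lambda> b)) = kron (cadj a) (modular Q (\<i> / 2) b)"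
  using Psi_theta(1)[OF _ gns] by simp

lemma \<Psi>_additive: "Modules.additive \<Psi>"
  unfolding Psi_def by (rule theta_extend_additive)

lemma \<Psi>_add: "\<Psi> (A + A') = \<Psi> A + \<Psi> A'"
  using \<Psi>_additive by (simp add: Modules.additive_def)

lemma additive_eq_on_\<Lambda>:
  fixes f g :: "complex^'l^'l \<Rightarrow> 'b::ab_group_add"
  assumes "Modules.additive f" "Modules.additive g"
    and "\<And>a b. a \<in> B \<Longrightarrow> b \<in> B \<Longrightarrow> f (theta (\<Lambda> a) (\<Lambda> b)) = g (theta (\<Lambda> a) (\<Lambda> b))"
  shows "f A = g A"
  using assms(1,2) by (rule additive_eq_on_theta) (metis \<Lambda>_surj assms(3))

text \<open>Hence the two maps agree wherever \<open>\<Psi> A\<close> is fixed by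
  \<open>swap\<close>, in particular on adjacency operators.\<close>

lemma Psi'_eq_swap: "Psi' B \<Lambda> Q A = swap (\<Psi> A)"
proof (rule additive_eq_on_\<Lambda>[where A = A])
  show "Modules.additive (Psi' B \<Lambda> Q)"
    unfolding Psi'_def by (rule theta_extend_additive)
  show "Modules.additive (\<lambda>A. swap (\<Psi> A))"
    by unfold_locales (simp add: \<Psi>_add swap_add)
qed (simp add: Psi_theta[OF _ gns] swap_kron)

text \<open>On \<open>theta (\<Lambda> a) (\<Lambda> b)\<close> both sides equal
  \<open>kron b (modular Q (- \<i> / 2) (cadj a))\<close>.\<close>

lemma \<Psi>_transpose_r: "\<Psi> (transpose_r B \<Lambda> A) = modular2 (- \<i> / 2) (swap (\<Psi> A))"
proof (rule additive_eq_on_\<Lambda>[where A = A])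
  show "Modules.additive (\<lambda>A. \<Psi> (transpose_r B \<Lambda> A))"
    using transpose_r_additive by unfold_locales (simp add: \<Psi>_add Modules.additive_def)
  show "Modules.additive (\<lambda>A. modular2 (- \<i> / 2) (swap (\<Psi> A)))"
    by unfold_locales (simp add: \<Psi>_add swap_add modular2_add)
qed (simp add: transpose_r_theta \<Psi>_theta swap_kron modular2_kron modular_modular modular_0)

text \<open>On \<open>theta (\<Lambda> a) (\<Lambda> b)\<close> both sides equal
  \<open>kron (modular Q \<i> b) (modular Q (\<i> / 2) (cadj a))\<close>.\<close>

lemma \<Psi>_transpose_l: "\<Psi> (transpose_l B \<Lambda> A) = modular2 (\<i> / 2) (swap (\<Psi> A))"
proof (rule additive_eq_on_\<Lambda>[where A = A])
  show "Modules.additive (\<lambda>A. \<Psi> (transpose_l B \<Lambda> A))"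
    using transpose_l_additive by unfold_locales (simp add: \<Psi>_add Modules.additive_def)
  show "Modules.additive (\<lambda>A. modular2 (\<i> / 2) (swap (\<Psi> A)))"
    by unfold_locales (simp add: \<Psi>_add swap_add modular2_add)
qed (simp add: transpose_l_theta \<Psi>_theta swap_kron modular2_kron modular_modular)

text \<open>Both sides are antilinear in \<open>A\<close>; on
  \<open>theta (\<Lambda> a) (\<Lambda> b)\<close> they equal
  \<open>kron (cadj b) (modular Q (\<i> / 2) a)\<close>.\<close>

lemma \<Psi>_cadj: "\<Psi> (cadj A) = modular2 (\<i> / 2) (swap (cadj (\<Psi> A)))"
proof (rule additive_eq_on_\<Lambda>[where A = A])
  show "Modules.additive (\<lambda>A. \<Psi> (cadj A))"
    by unfold_locales (simp add: \<Psi>_add cadj_add)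
  show "Modules.additive (\<lambda>A. modular2 (\<i> / 2) (swap (cadj (\<Psi> A))))"
    by unfold_locales (simp add: \<Psi>_add swap_add modular2_add cadj_add)
qed (simp add: cadj_theta \<Psi>_theta cadj_kron swap_kron modular2_kron cadj_modular modular_modular modular_0)

text \<open>The order is reversed because \<open>cadj\<close> reverses products in the first leg and
  \<open>op_mult\<close> does so in the second. For \<open>A' = A\<close> the condition becomes
  idempotency.\<close>

lemma \<Psi>_schur: "\<Psi> (gns_mult B \<Lambda> ** kron A A' ** cadj (gns_mult B \<Lambda>)) = op_mult (\<Psi> A') (\<Psi> A)"
proof (rule additive_eq_on_\<Lambda>[where A = A])
  show "Modules.additive (\<lambda>A. \<Psi> (gns_mult B \<Lambda> ** kron A A' ** cadj (gns_mult B \<Lambda>)))"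
    by unfold_locales (simp add: \<Psi>_add kron_add_left matrix_add_ldistrib matrix_add_mult_left)
  show "Modules.additive (\<lambda>A. op_mult (\<Psi> A') (\<Psi> A))"
    by unfold_locales (simp add: \<Psi>_add op_mult_add_right)
  fix a b assume ab: "a \<in> B" "b \<in> B"
  show "\<Psi> (gns_mult B \<Lambda> ** kron (theta (\<Lambda> a) (\<Lambda> b)) A' ** cadj (gns_mult B \<Lambda>)) = op_mult (\<Psi> A') (\<Psi> (theta (\<Lambda> a) (\<Lambda> b)))"
  proof (rule additive_eq_on_\<Lambda>[where A = A'])
    show "Modules.additive (\<lambda>A'. \<Psi> (gns_mult B \<Lambda> ** kron (theta (\<Lambda> a) (\<Lambda> b)) A' ** cadj (gns_mult B \<Lambda>)))"
      by unfold_locales (simp add: \<Psi>_add kron_add_right matrix_add_ldistrib matrix_add_mult_left)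
    show "Modules.additive (\<lambda>A'. op_mult (\<Psi> A') (\<Psi> (theta (\<Lambda> a) (\<Lambda> b))))"
      by unfold_locales (simp add: \<Psi>_add op_mult_add_left)
    fix c d assume cd: "c \<in> B" "d \<in> B"
    show "\<Psi> (gns_mult B \<Lambda> ** kron (theta (\<Lambda> a) (\<Lambda> b)) (theta (\<Lambda> c) (\<Lambda> d)) ** cadj (gns_mult B \<Lambda>))
      = op_mult (\<Psi> (theta (\<Lambda> c) (\<Lambda> d))) (\<Psi> (theta (\<Lambda> a) (\<Lambda> b)))"
      using ab cd by (simp add: kron_theta mult_theta theta_mult_cadj gns_mult_tensor[OF B gns] \<Psi>_theta
          op_mult_kron cadj_mult modular_mult)
  qed
qed

section \<open>Bijectivity of \<open>\<Psi>\<close> onto the tensor algebra\<close>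

lemma \<Lambda>_combination:
  "\<Lambda> (\<Sum>p\<in>UNIV. cscale (c p) (basis_element p)) = (\<chi> p. c p)"
proof -
  have "\<Lambda> (\<Sum>p\<in>UNIV. cscale (c p) (basis_element p)) = (\<Sum>p\<in>UNIV. c p *s axis p 1)"
    by (simp add: clinear_on_sum[OF _ \<Lambda>_linear])
  also have "\<dots> = (\<chi> p. c p)"
    using basis_expansion[of "\<chi> p. c p"] by simp
  finally show ?thesis .
qed

lemma combination_zero:
  assumes "(\<Sum>p\<in>UNIV. cscale (c p) (basis_element p)) = 0"
  shows "c p = 0"
proof -
  have "\<Lambda> (cscale 0 0) = 0 *s \<Lambda> 0" using \<Lambda>_linear B_closed(7) unfolding clinear_on_def by blast
  then have "\<Lambda> 0 = 0" by simp
  then have "(\<chi> p. c p) = (0 :: complex^'l)" using \<Lambda>_combination[of c] assms by simp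
  then show ?thesis by (simp add: vec_eq_iff)
qed

text \<open>Fixing an entry of the first leg leaves a vanishing combination of the
  \<open>modular Q (\<i> / 2) (basis_element q)\<close>. As \<open>modular\<close> is invertible and
  the basis elements are independent, its coefficients vanish; independence, used again in the first
  leg, then gives \<open>A = 0\<close>.\<close>

lemma \<Psi>_eq_0:
  assumes "\<Psi> A = 0" shows "A = 0"
proof -
  have "A $ q $ p = 0" for p q
  proof -
    have mod_zero: "modular Q z 0 = 0" for z by (simp add: modular_def)
    have "(\<Sum>p\<in>UNIV. cscale (cnj (A $ q $ p)) (basis_element p)) = 0" for q
    proof -
      have "(\<Sum>p\<in>UNIV. A $ q $ p * cnj (basis_element p $ j $ i)) = 0" for i j
      proof -
        \<comment> \<open>The \<open>(i, j)\<close> entry of the first leg, collected as the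
          coefficient of the second-leg basis element \<open>q\<close>.\<close>
        define c where "c q = (\<Sum>p\<in>UNIV. A $ q $ p * cnj (basis_element p $ j $ i))" for q
        have "modular Q (\<i> / 2) (\<Sum>q\<in>UNIV. cscale (c q) (basis_element q)) = (\<Sum>q\<in>UNIV. cscale (c q) (modular Q (\<i> / 2) (basis_element q)))"
          by (rule clinear_on_sum[OF cmat.subspace_UNIV modular_linear]) simp_all
        also have "\<dots> = 0"
        proof -
          have "(\<Sum>q\<in>UNIV. cscale (c q) (modular Q (\<i> / 2) (basis_element q))) $ k $ l = \<Psi> A $ (i, k) $ (j, l)" for k l
          proof -
            have "\<Psi> A $ (i, k) $ (j, l) = (\<Sum>p\<in>UNIV. \<Sum>q\<in>UNIV. A $ q $ p * (cnj (basis_element p $ j $ i) * modular Q (\<i> / 2) (basis_element q) $ k $ l))"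
              by (simp add: Psi_def theta_extend_def cscale_nth kron_def cadj_def)
            also have "\<dots> = (\<Sum>q\<in>UNIV. \<Sum>p\<in>UNIV. A $ q $ p * (cnj (basis_element p $ j $ i) * modular Q (\<i> / 2) (basis_element q) $ k $ l))"
              by (rule sum.swap)
            finally show ?thesis by (simp add: cscale_nth c_def sum_distrib_right mult.assoc)
          qed
          then show ?thesis using assms by (simp add: vec_eq_iff)
        qed
        finally have "modular Q (- \<i> / 2) (modular Q (\<i> / 2) (\<Sum>q\<in>UNIV. cscale (c q) (basis_element q))) = 0"
          by (simp add: mod_zero)
        then have "(\<Sum>q\<in>UNIV. cscale (c q) (basis_element q)) = 0"
          by (simp add: modular_modular modular_0)
        then show ?thesis unfolding c_def[symmetric] by (rule combination_zero)
      qed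
      \<comment> \<open>The first leg carries adjoints, so conjugation exhibits a linear combination
        of the basis elements themselves.\<close>
      then have "cnj (\<Sum>p\<in>UNIV. A $ q $ p * cnj (basis_element p $ j $ i)) = 0" for i j by simp
      then show ?thesis by (simp add: vec_eq_iff cscale_nth)
    qed
    then have "cnj (A $ q $ p) = 0" by (rule combination_zero)
    then show ?thesis by simp
  qed
  then show ?thesis by (simp add: vec_eq_iff)
qed

lemma \<Psi>_inj: "inj \<Psi>"
proof
  fix A A' assume "\<Psi> A = \<Psi> A'"
  then have "\<Psi> (A - A') = 0" using Modules.additive.diff[OF \<Psi>_additive] by simp
  then show "A = A'" using \<Psi>_eq_0 by fastforce
qed

lemma \<Psi>_in_tensor_alg: "\<Psi> A \<in> tensor_alg B"
  unfolding Psi_def theta_extend_def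
  by (intro cmat.subspace_sum[OF tensor_alg_subspace] cmat.subspace_scale[OF tensor_alg_subspace]
      kron_in_tensor_alg) simp_all

lemma \<Psi>_surj:
  assumes "e \<in> tensor_alg B" obtains A where "e = \<Psi> A"
proof -
  from assms B_closed(1) have "e \<in> range \<Psi>"
  proof (induction rule: tensor_alg_induct)
    case zero
    then show ?case using Modules.additive.zero[OF \<Psi>_additive] by (metis rangeI)
  next
    case (add x y)
    then obtain A A' where "x = \<Psi> A" "y = \<Psi> A'" by blast
    then have "x + y = \<Psi> (A + A')" by (simp add: \<Psi>_add)
    then show ?case by blast
  next
    case (kron a b)
    \<comment> \<open>The preimage undoes the adjoint in the first leg and
      \<open>modular Q (\<i> / 2)\<close> in the second.\<close>
    then have "kron a b = \<Psi> (theta (\<Lambda> (cadj a)) (\<Lambda> (modular Q (- \<i> / 2) b)))"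
      by (simp add: \<Psi>_theta modular_modular modular_0)
    then show ?case by blast
  qed
  then show ?thesis using that by blast
qed

section \<open>Translation of the adjacency conditions\<close>

lemma modular2_shift: "modular2 z x = y \<longleftrightarrow> x = modular2 (- z) y"
  by (metis add.right_inverse add.left_inverse modular2_0 modular2_modular2)

text \<open>Through \<open>\<Psi>\<close> the two transposes become mutually inverse, since
  \<open>swap\<close> is an involution commuting with \<open>modular2\<close>; so they have the same
  fixed points.\<close>

lemma transpose_l_fixed_iff: "transpose_l B \<Lambda> A = A \<longleftrightarrow> transpose_r B \<Lambda> A = A"
proof -
  have "transpose_l B \<Lambda> A = A \<longleftrightarrow> modular2 (\<i> / 2) (swap (\<Psi> A)) = \<Psi> A"
    using \<Psi>_inj by (metis \<Psi>_transpose_l injD)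
  also have "\<dots> \<longleftrightarrow> swap (\<Psi> A) = modular2 (- \<i> / 2) (\<Psi> A)"
    by (simp add: modular2_shift)
  also have "\<dots> \<longleftrightarrow> modular2 (- \<i> / 2) (swap (\<Psi> A)) = \<Psi> A"
    by (metis swap_swap swap_modular2)
  also have "\<dots> \<longleftrightarrow> transpose_r B \<Lambda> A = A"
    using \<Psi>_inj by (metis \<Psi>_transpose_r injD)
  finally show ?thesis .
qed

lemma adjacency_ops_r_eq_l: "adjacency_ops_r B \<Lambda> = adjacency_ops_l B \<Lambda>"
  by (simp add: adjacency_ops_r_def adjacency_ops_l_def transpose_l_fixed_iff)

text \<open>Taken alone, the adjoint and transpose conditions translate into equations twisted by
  \<open>modular2\<close>. Together they force invariance at \<open>\<i>\<close>, hence at all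
  parameters, and the twists disappear.\<close>

lemma adjacency_iff_projection: "A \<in> adjacency_ops_r B \<Lambda> \<longleftrightarrow> \<Psi> A \<in> invariant_projections B Q"
proof -
  define e where "e = \<Psi> A"
  have adj: "cadj A = A \<longleftrightarrow> modular2 (\<i> / 2) (swap (cadj e)) = e"
    unfolding e_def using \<Psi>_inj by (metis \<Psi>_cadj injD)
  have idem: "gns_mult B \<Lambda> ** kron A A ** cadj (gns_mult B \<Lambda>) = A \<longleftrightarrow> op_mult e e = e"
    unfolding e_def using \<Psi>_inj by (metis \<Psi>_schur injD)
  have tr: "transpose_r B \<Lambda> A = A \<longleftrightarrow> modular2 (- \<i> / 2) (swap e) = e"
    unfolding e_def using \<Psi>_inj by (metis \<Psi>_transpose_r injD)
  have "modular2 (\<i> / 2) (swap (cadj e)) = e \<and> modular2 (- \<i> / 2) (swap e) = e \<longleftrightarrow>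
      cadj e = e \<and> e = swap e \<and> (\<forall>z. e = modular2 z e)"
  proof
    assume fixed: "modular2 (\<i> / 2) (swap (cadj e)) = e \<and> modular2 (- \<i> / 2) (swap e) = e"
    then have "swap (cadj e) = modular2 (- \<i> / 2) e" and sw: "swap e = modular2 (\<i> / 2) e"
      by (simp_all add: modular2_shift)
    \<comment> \<open>After a \<open>swap\<close>, the adjoint condition computes
      \<open>cadj e\<close> as the very expression that the transpose condition equates with
      \<open>e\<close>.\<close>
    then have "cadj e = modular2 (- \<i> / 2) (swap e)" by (metis swap_swap swap_modular2)
    then have self: "cadj e = e" using fixed by simp
    \<comment> \<open>Both conditions now evaluate \<open>swap e\<close>; comparing the results
      leaves invariance at \<open>\<i>\<close>.\<close>
    then have "modular2 (\<i> / 2) e = modular2 (- \<i> / 2) e"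
      using \<open>swap (cadj e) = modular2 (- \<i> / 2) e\<close> sw by simp
    then have "modular2 \<i> e = e" by (simp add: modular2_shift modular2_modular2)
    then have "modular2 z e = e" for z by (rule modular2_invariant)
    then show "cadj e = e \<and> e = swap e \<and> (\<forall>z. e = modular2 z e)" using self sw by simp
  next
    assume "cadj e = e \<and> e = swap e \<and> (\<forall>z. e = modular2 z e)"
    then show "modular2 (\<i> / 2) (swap (cadj e)) = e \<and> modular2 (- \<i> / 2) (swap e) = e" by metis
  qed
  then show ?thesis
    using \<Psi>_in_tensor_alg[of A]
    unfolding adjacency_ops_r_def invariant_projections_def mem_Collect_eq e_def[symmetric] adj idem tr by blast
qed

lemma bij_adjacency_projections:
  "bij_betw \<Psi> (adjacency_ops_r B \<Lambda>) (invariant_projections B Q)"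
proof (rule bij_betwI')
  show "(\<Psi> A = \<Psi> A') = (A = A')" for A A' using \<Psi>_inj by (rule inj_eq)
  show "\<Psi> A \<in> invariant_projections B Q" if "A \<in> adjacency_ops_r B \<Lambda>" for A
    using that by (simp add: adjacency_iff_projection)
  show "\<exists>A\<in>adjacency_ops_r B \<Lambda>. e = \<Psi> A" if "e \<in> invariant_projections B Q" for e
    by (metis (no_types, lifting) \<Psi>_surj adjacency_iff_projection invariant_projections_def mem_Collect_eq that)
qed

text \<open>The images of adjacency operators are fixed by \<open>swap\<close>, so there
  \<open>Psi'\<close> coincides with \<open>\<Psi>\<close>.\<close>

lemma bij_adjacency_projections':
  "bij_betw (Psi' B \<Lambda> Q) (adjacency_ops_r B \<Lambda>) (invariant_projections B Q)"
proof -
  have "Psi' B \<Lambda> Q A = \<Psi> A" if "A \<in> adjacency_ops_r B \<Lambda>" for A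
    using that by (simp add: adjacency_iff_projection invariant_projections_def Psi'_eq_swap)
  then show ?thesis using bij_adjacency_projections bij_betw_cong by metis
qed

end

theorem theorem5p17:
  fixes B :: "(complex^'n^'n) set"
    and blk :: "'d::finite \<Rightarrow> nat" and \<phi> :: "complex^'n^'n \<Rightarrow> complex^'d^'d"
    and \<psi> :: "complex^'n^'n \<Rightarrow> complex" and Q :: "complex^'n^'n"
    and \<Lambda> :: "complex^'n^'n \<Rightarrow> complex^'l"
    and \<Phi> :: "complex^'l^'l \<Rightarrow> complex^('n \<times> 'n)^('n \<times> 'n)"
  assumes "unital_star_subalgebra B"
    and "star_isomorphism B (block_diagonal blk) \<phi>"
    and "faithful_state B \<psi>"
    and "Q \<in> B" and "positive_op Q" and "invertible Q"
    and "\<forall>a\<in>B. \<psi> a = trace (\<phi> (Q ** a))"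
    and "gns_map B \<psi> \<Lambda>"
    and "\<Phi> = Psi B \<Lambda> Q \<or> \<Phi> = Psi' B \<Lambda> Q"
  shows "bij_betw \<Phi> (adjacency_ops_r B \<Lambda>) (invariant_projections B Q) \<and>
    bij_betw (\<lambda>e. range (\<lambda>v. op_act e *v v)) (invariant_projections B Q)
       {V \<in> symmetric_invariant_subspaces B. (\<lambda>v. kron Q (transpose (matrix_inv Q)) *v v) ` V \<subseteq> V} \<and>
    bij_betw (\<lambda>V. op_of_vec ` V)
       {V \<in> symmetric_invariant_subspaces B. (\<lambda>v. kron Q (transpose (matrix_inv Q)) *v v) ` V \<subseteq> V}
       {S \<in> selfadjoint_bimodules B. (\<lambda>s. Q ** s ** matrix_inv Q) ` S \<subseteq> S} \<and>
    adjacency_ops_r B \<Lambda> = adjacency_ops_l B \<Lambda> \<and>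
    (\<forall>V\<in>symmetric_invariant_subspaces B.
       (\<lambda>v. kron Q (transpose (matrix_inv Q)) *v v) ` V \<subseteq> V \<longleftrightarrow>
       (\<lambda>v. kron Q (transpose (matrix_inv Q)) *v v) ` V = V) \<and>
    (\<forall>S\<in>selfadjoint_bimodules B.
       (\<lambda>s. Q ** s ** matrix_inv Q) ` S \<subseteq> S \<longleftrightarrow> (\<lambda>s. Q ** s ** matrix_inv Q) ` S = S)"
proof -
  have \<phi>_mult: "\<phi> (a ** b) = \<phi> a ** \<phi> b" if "a \<in> B" "b \<in> B" for a b
    using assms(2) that unfolding star_isomorphism_def by blast
  \<comment> \<open>The trace is pulled back along \<open>\<phi>\<close>, so its trace property
    follows from multiplicativity of \<open>\<phi>\<close> on \<open>B\<close>.\<close>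
  interpret weighted_gns Q B "\<lambda>a. trace (\<phi> a)" \<psi> \<Lambda>
  proof unfold_locales
    show "trace (\<phi> (a ** b)) = trace (\<phi> (b ** a))" if "a \<in> B" "b \<in> B" for a b
      by (simp only: \<phi>_mult that) (rule trace_mul_sym)
  qed (use assms in auto)
  have "bij_betw \<Phi> (adjacency_ops_r B \<Lambda>) (invariant_projections B Q)"
    using assms(9) bij_adjacency_projections bij_adjacency_projections' by blast
  moreover note bij_projections_subspaces[OF B] bij_subspaces_bimodules[OF B] adjacency_ops_r_eq_l
  moreover have "(\<lambda>v. weight_op *v v) ` V \<subseteq> V \<longleftrightarrow> (\<lambda>v. weight_op *v v) ` V = V"
    if "V \<in> symmetric_invariant_subspaces B" for V
    using weight_op_image_eq[of V] that by (auto simp: symmetric_invariant_subspaces_def)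
  moreover have "(\<lambda>s. Q ** s ** matrix_inv Q) ` S \<subseteq> S \<longleftrightarrow> (\<lambda>s. Q ** s ** matrix_inv Q) ` S = S"
    if "S \<in> selfadjoint_bimodules B" for S
    using conjugation_image_eq[OF B that] by auto
  ultimately show ?thesis
    unfolding weight_op_def by blast
qed

end
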